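(* Fix a positive integer $n$ and a field $k$, let $S=k[x_1,\ldots,x_n]$, and let $p=p(D)\in[0,1]$ be a function of $D$. For each positive integer $D$ let $M\sim\mathcal{M}(n,D,p)$ be a random monomial ideal. Then, as $D\to\infty$, $p=D^{-n+1}$ is a threshold for the projective dimension of $S/M$ in the following sense: (i) if $p\ll D^{-n+1}$, then $\operatorname{pdim}(S/M)=0$ asymptotically almost surely; (ii) if $p\gg D^{-n+1}$, then $\operatorname{pdim}(S/M)=n$ asymptotically almost surely.
   Context: The model $\mathcal{M}(n,D,p)$: a random set $G$ of monomials of $S=k[x_1,\ldots,x_n]$ is obtained by including each monomial of total degree exactly $D$ in $G$ independently with probability $p$ (and no other monomials); then $M=\langle G\rangle$ (so $M=\langle 0\rangle$ if $G=\emptyset$). Since all elements of $G$ have the same degree, $G$ is the minimal monomial generating set of $M$. Here $n$ is fixed and $p$ may depend on $D$. For functions $f,g$ of $D$, $f\ll g$ (equivalently $g\gg f$) means $\lim_{D\to\infty}f(D)/g(D)=0$. An event holds asymptotically almost surely if its probability tends to $1$ as $D\to\infty$. $\operatorname{pdim}(S/M)$ is the minimum length of a free resolution of $S/M$ over $S$. *)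

theory Defs
  imports
    "HOL-Probability.Probability"
    "HOL-Library.Poly_Mapping"
    "HOL-Library.Set_Algebras"
    "HOL-Library.Infinite_Typeclass"
begin

section \<open>Projective dimension of a cyclic module\<close>

text \<open>
  The type \<^typ>\<open>'i \<Rightarrow>\<^sub>0 'r\<close> of finitely supported functions is the free
  \<^typ>\<open>'r\<close>-module with basis \<^typ>\<open>'i\<close>; the free module with basis \<open>B\<close>, for an
  arbitrary set \<open>B\<close> of elements of \<^typ>\<open>'i\<close>, is its submodule of functions supported in \<open>B\<close>.
\<close>

definition free_mod :: "'i set \<Rightarrow> ('i \<Rightarrow>\<^sub>0 'r::comm_ring_1) set" where
  "free_mod B = {v. Poly_Mapping.keys v \<subseteq> B}"

definition scale :: "'r::comm_ring_1 \<Rightarrow> ('i \<Rightarrow>\<^sub>0 'r) \<Rightarrow> ('i \<Rightarrow>\<^sub>0 'r)" where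
  "scale r v = Poly_Mapping.map ((*) r) v"

text \<open>
  The quotient module \<open>R/J\<close>: its elements are the cosets of \<open>J\<close>, its addition is the elementwise
  sum of cosets (the addition on sets from \<^theory>\<open>HOL-Library.Set_Algebras\<close>), its zero
  is \<open>J\<close>. The summand \<open>J\<close> in the scalar multiplication is needed because the elementwise
  product of \<open>r\<close> with a coset is in general a proper subset of a coset.
\<close>

definition quot :: "'r::comm_ring_1 set \<Rightarrow> 'r set set" where
  "quot J = range (\<lambda>a. a +o J)"

definition quot_scale :: "'r::comm_ring_1 set \<Rightarrow> 'r \<Rightarrow> 'r set \<Rightarrow> 'r set" where
  "quot_scale J r X = (r *o X) + J"

text \<open>
  \<open>f\<close> is linear on the free module with basis \<open>B\<close> and has values in the module with
  carrier \<open>N\<close>, addition \<open>addN\<close> and scalar multiplication \<open>scaleN\<close>. The values of \<open>f\<close> outside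
  the free module are irrelevant.
\<close>

definition hom_on ::
  "'i set \<Rightarrow> 'b set \<Rightarrow> ('b \<Rightarrow> 'b \<Rightarrow> 'b) \<Rightarrow> ('r::comm_ring_1 \<Rightarrow> 'b \<Rightarrow> 'b)
    \<Rightarrow> (('i \<Rightarrow>\<^sub>0 'r) \<Rightarrow> 'b) \<Rightarrow> bool" where
  "hom_on B N addN scaleN f \<longleftrightarrow>
     f ` free_mod B \<subseteq> N \<and>
     (\<forall>u\<in>free_mod B. \<forall>v\<in>free_mod B. f (u + v) = addN (f u) (f v)) \<and>
     (\<forall>r. \<forall>v\<in>free_mod B. f (scale r v) = scaleN r (f v))"

text \<open>
  A free resolution \<open>0 \<rightarrow> F\<^sub>l \<rightarrow> \<dots> \<rightarrow> F\<^sub>1 \<rightarrow> F\<^sub>0 \<rightarrow> R/J \<rightarrow> 0\<close>, where \<open>F\<^sub>i\<close> is the free module with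
  basis \<open>B i\<close>, the map \<open>d i\<close> goes from \<open>F\<^sub>i\<^sub>+\<^sub>1\<close> to \<open>F\<^sub>i\<close>, and \<open>\<epsilon>\<close> is the augmentation. It is
  extended by \<open>F\<^sub>i = 0\<close> for \<open>i > l\<close>, so that exactness at the left end is not a special case.
\<close>

definition free_resolution ::
  "'r::comm_ring_1 set \<Rightarrow> nat \<Rightarrow> (nat \<Rightarrow> 'i set)
    \<Rightarrow> (nat \<Rightarrow> ('i \<Rightarrow>\<^sub>0 'r) \<Rightarrow> ('i \<Rightarrow>\<^sub>0 'r)) \<Rightarrow> (('i \<Rightarrow>\<^sub>0 'r) \<Rightarrow> 'r set) \<Rightarrow> bool" where
  "free_resolution J l B d \<epsilon> \<longleftrightarrow>
     (\<forall>i>l. B i = {}) \<and>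
     hom_on (B 0) (quot J) (+) (quot_scale J) \<epsilon> \<and>
     (\<forall>i. hom_on (B (Suc i)) (free_mod (B i)) (+) scale (d i)) \<and>
     \<epsilon> ` free_mod (B 0) = quot J \<and>
     {v \<in> free_mod (B 0). \<epsilon> v = J} = d 0 ` free_mod (B 1) \<and>
     (\<forall>i. {v \<in> free_mod (B (Suc i)). d i v = 0} = d (Suc i) ` free_mod (B (Suc (Suc i))))"

text \<open>
  The projective dimension of \<open>R/J\<close>, i.e. the minimum length of a free resolution (\<open>\<infinity>\<close> if there
  is none of finite length). HOL cannot quantify over all index sets, so the bases are
  taken from a type \<^typ>\<open>'i\<close>, which is a parameter; facts stated for all infinite types
  \<^typ>\<open>'i\<close> cover free modules of arbitrary rank.
\<close>

definition pdim_quot :: "'i::infinite itself \<Rightarrow> 'r::comm_ring_1 set \<Rightarrow> enat" where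
  "pdim_quot _ J =
     Inf {enat l | l. \<exists>(B :: nat \<Rightarrow> 'i set) d \<epsilon>. free_resolution J l B d \<epsilon>}"


section \<open>Random monomial ideals\<close>

text \<open>
  The variables of the polynomial ring are indexed by a finite type \<^typ>\<open>'n\<close>, so their number
  is \<^term>\<open>CARD('n)\<close>. A monomial is identified with its exponent vector.
\<close>

type_synonym 'n monom = "'n \<Rightarrow>\<^sub>0 nat"
type_synonym ('n, 'k) mpoly = "'n monom \<Rightarrow>\<^sub>0 'k"

definition monoms_of_degree :: "nat \<Rightarrow> 'n::finite monom set" where
  "monoms_of_degree D = {m. (\<Sum>x\<in>UNIV. Poly_Mapping.lookup m x) = D}"

lemma finite_monoms_of_degree: "finite (monoms_of_degree D :: 'n::finite monom set)"
proof (rule finite_imageD)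
  have "Poly_Mapping.lookup ` (monoms_of_degree D :: 'n monom set)
      \<subseteq> Pi\<^sub>E UNIV (\<lambda>_. {..D})"
    by (auto simp: monoms_of_degree_def intro!: member_le_sum)
  then show "finite (Poly_Mapping.lookup ` (monoms_of_degree D :: 'n monom set))"
    by (rule finite_subset) (intro finite_PiE, auto)
  show "inj_on Poly_Mapping.lookup (monoms_of_degree D :: 'n monom set)"
    by (auto intro!: inj_onI poly_mapping_eqI)
qed

definition random_gens :: "nat \<Rightarrow> real \<Rightarrow> 'n::finite monom set pmf" where
  "random_gens D p =
     map_pmf (\<lambda>f. {m. f m}) (Pi_pmf (monoms_of_degree D) False (\<lambda>_. bernoulli_pmf p))"

text \<open>The span of a set in the ring, regarded as a module over itself, is the ideal it generates.\<close>

definition monomial_ideal :: "'n monom set \<Rightarrow> ('n, 'k::field) mpoly set" where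
  "monomial_ideal G = module.span (*) ((\<lambda>m. Poly_Mapping.single m 1) ` G)"

definition random_monomial_ideal :: "nat \<Rightarrow> real \<Rightarrow> ('n::finite, 'k::field) mpoly set pmf" where
  "random_monomial_ideal D p = map_pmf monomial_ideal (random_gens D p)"


section \<open>Asymptotics\<close>

text \<open>
  The first conjunct says that the quotient \<open>f D / g D\<close> is defined for large \<open>D\<close>; it
  cannot be omitted, because \<open>x / 0 = 0\<close> in HOL.
\<close>

definition much_less :: "(nat \<Rightarrow> real) \<Rightarrow> (nat \<Rightarrow> real) \<Rightarrow> bool"  (infix \<open>\<lless>\<close> 50) where
  "f \<lless> g \<longleftrightarrow> (\<forall>\<^sub>F D in sequentially. g D \<noteq> 0) \<and> (\<lambda>D. f D / g D) \<longlonglongrightarrow> 0"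

definition asymp_almost_surely :: "(nat \<Rightarrow> 'a pmf) \<Rightarrow> ('a \<Rightarrow> bool) \<Rightarrow> bool" where
  "asymp_almost_surely X P \<longleftrightarrow> (\<lambda>D. measure_pmf.prob (X D) {x. P x}) \<longlonglongrightarrow> 1"

end

theory Submission
  imports Defs
begin

text \<open>
  For small \<open>p\<close> the set of generators is almost surely empty, by Bernoulli's inequality, and then
  \<open>S/M = S\<close>. For large \<open>p\<close> put \<open>c = (D - 1) div n\<close>. For each \<open>i\<close> there are at least
  \<open>(c + 1)^(n - 1)\<close> monomials of degree \<open>D\<close> all of whose exponents except the \<open>i\<close>-th are at most \<open>c\<close>,
  so almost surely a generator of this shape occurs for every \<open>i\<close>. Then the multiples of
  \<open>(x\<^sub>1\<cdots>x\<^sub>n)^c\<close> outside \<open>M\<close> are finite in number, and they exist because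
  \<open>(x\<^sub>1\<cdots>x\<^sub>n)^c\<close> has degree less than \<open>D\<close>. One of maximal degree is a socle element of \<open>S/M\<close>.

  A socle element \<open>w\<close> is a nonzero cycle of degree \<open>n\<close> of the Koszul complex of the variables with
  coefficients in \<open>S/M\<close>; as that Koszul complex is exact over free modules, a diagram chase through a
  free resolution shows that its length is at least \<open>n\<close>. A resolution of length \<open>n\<close> is
  the Koszul complex of the commuting operators \<open>x\<^sub>j - \<tau>\<^sub>j\<close> on the free module over the standard
  monomials (those not in \<open>M\<close>), where \<open>\<tau>\<^sub>j\<close> multiplies a basis element by \<open>x\<^sub>j\<close> and
  sends it to \<open>0\<close> if the product is in \<open>M\<close>.
\<close>

section \<open>Koszul complexes of commuting operators\<close>

text \<open>A basis element of the exterior algebra is a subset of the list of operators, encoded as its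
  indicator list; \<open>chains n i N\<close> are the Koszul chains of degree \<open>i\<close> for \<open>n\<close> operators on \<open>N\<close>.\<close>

definition chains :: "nat \<Rightarrow> nat \<Rightarrow> 'a::ab_group_add set \<Rightarrow> (bool list \<Rightarrow> 'a) set" where
  "chains n i N =
     {c. \<forall>A. c A \<in> N \<and> (c A \<noteq> 0 \<longrightarrow> length A = n \<and> count_list A True = i)}"

text \<open>Splitting off the first operator as \<open>c = c0 + e_j c1\<close> makes the complex the
  mapping cone of \<open>X j\<close> on the Koszul complex of \<open>js\<close>. The sign in the
  \<open>True\<close> clause is that of moving the differential past \<open>e_j\<close>.\<close>

primrec boundary ::
  "('j \<Rightarrow> 'a \<Rightarrow> 'a) \<Rightarrow> 'j list \<Rightarrow> (bool list \<Rightarrow> 'a) \<Rightarrow> bool list \<Rightarrow> 'a::ab_group_add" where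
  "boundary X [] c A = 0"
| "boundary X (j # js) c A =
     (case A of [] \<Rightarrow> 0
      | a # A' \<Rightarrow>
          if a then - boundary X js (\<lambda>B. c (True # B)) A'
          else X j (c (True # A')) + boundary X js (\<lambda>B. c (False # B)) A')"

definition join :: "(bool list \<Rightarrow> 'a) \<Rightarrow> (bool list \<Rightarrow> 'a) \<Rightarrow> bool list \<Rightarrow> 'a::zero" where
  "join c0 c1 A = (case A of [] \<Rightarrow> 0 | a # A' \<Rightarrow> if a then c1 A' else c0 A')"

lemma join_simps [simp]:
  "join c0 c1 [] = 0" "join c0 c1 (True # A) = c1 A" "join c0 c1 (False # A) = c0 A"
  by (simp_all add: join_def)

lemma count_list_True_0: "count_list A True = 0 \<longleftrightarrow> A = replicate (length A) False"
  by (induction A) auto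

lemma chains_mem: "c \<in> chains n i N \<Longrightarrow> c A \<in> N"
  by (simp add: chains_def)

lemma chains_True: "c \<in> chains (Suc n) (Suc i) N \<Longrightarrow> (\<lambda>A. c (True # A)) \<in> chains n i N"
  by (fastforce simp: chains_def)

lemma chains_False: "c \<in> chains (Suc n) i N \<Longrightarrow> (\<lambda>A. c (False # A)) \<in> chains n i N"
  by (fastforce simp: chains_def)

lemma chains_too_big:
  assumes "c \<in> chains n i N" "n < i"
  shows "c A = 0"
proof (rule ccontr)
  assume "c A \<noteq> 0"
  then have "length A = n" "count_list A True = i"
    using assms(1) by (auto simp: chains_def)
  then show False
    using count_le_length[of A True] assms(2) by simp
qed

text \<open>The algebraic laws are required on the whole type and only closure refers to
  \<open>N\<close>. Identities between boundaries then carry no membership conditions, while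
  \<open>N\<close> records the free module in question.\<close>

locale commuting_endos =
  fixes N :: "'a::ab_group_add set" and X :: "'j \<Rightarrow> 'a \<Rightarrow> 'a"
  assumes zero_mem: "0 \<in> N"
    and add_mem: "u \<in> N \<Longrightarrow> v \<in> N \<Longrightarrow> u + v \<in> N"
    and uminus_mem: "v \<in> N \<Longrightarrow> - v \<in> N"
    and X_mem: "v \<in> N \<Longrightarrow> X j v \<in> N"
    and X_add: "X j (u + v) = X j u + X j v"
    and X_X: "X i (X j v) = X j (X i v)"
begin

lemma diff_mem: "u \<in> N \<Longrightarrow> v \<in> N \<Longrightarrow> u - v \<in> N"
  using add_mem uminus_mem by (metis diff_conv_add_uminus)

lemma X_0 [simp]: "X j 0 = 0"
  using X_add[of j 0 0] by simp

lemma X_uminus: "X j (- v) = - X j v"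
  using X_add[of j v "- v"] by (simp add: add_eq_0_iff)

lemma X_diff: "X j (u - v) = X j u - X j v"
  using X_add[of j u "- v"] by (simp add: X_uminus)

lemma boundary_mem: "(\<And>A. c A \<in> N) \<Longrightarrow> boundary X js c A \<in> N"
  by (induction js arbitrary: c A)
     (auto simp: zero_mem add_mem uminus_mem X_mem split: list.split)

text \<open>Functoriality in the coefficients. Additivity of \<open>h\<close> is demanded on
  \<open>N\<close> alone, since the differentials of a resolution are linear only on the free
  modules where they live.\<close>

lemma boundary_hom:
  assumes "\<And>u v. u \<in> N \<Longrightarrow> v \<in> N \<Longrightarrow> h (u + v) = h u + h v"
    and "\<And>j v. j \<in> set js \<Longrightarrow> v \<in> N \<Longrightarrow> h (X j v) = X j (h v)"
    and "\<And>A. c A \<in> N"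
  shows "boundary X js (\<lambda>A. h (c A)) A = h (boundary X js c A)"
proof -
  have h0: "h 0 = 0"
    using assms(1)[of 0 0] zero_mem by simp
  have hm: "h (- v) = - h v" if "v \<in> N" for v
    using assms(1)[of v "- v"] that uminus_mem h0 by (simp add: add_eq_0_iff)
  show ?thesis
    using assms(2,3)
  proof (induction js arbitrary: c A)
    case (Cons j js)
    have IH: "boundary X js (\<lambda>A. h (c (a # A))) A' = h (boundary X js (\<lambda>A. c (a # A)) A')" for a A'
      by (rule Cons.IH) (use Cons.prems in auto)
    have mem: "boundary X js (\<lambda>A. c (a # A)) A' \<in> N" for a A'
      by (rule boundary_mem) (rule Cons.prems)
    show ?case
      by (auto simp: h0 hm IH mem assms(1) Cons.prems X_mem split: list.split)
  qed (simp add: h0)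
qed

lemma boundary_0 [simp]: "boundary X js (\<lambda>_. 0) A = 0"
  by (induction js arbitrary: A) (auto split: list.split)

lemma boundary_add: "boundary X js (\<lambda>A. c A + c' A) A = boundary X js c A + boundary X js c' A"
  by (induction js arbitrary: c c' A) (auto simp: X_add algebra_simps split: list.split)

lemma boundary_uminus: "boundary X js (\<lambda>A. - c A) A = - boundary X js c A"
  using boundary_add[of js c "\<lambda>A. - c A" A] by (simp add: add_eq_0_iff)

lemma boundary_diff: "boundary X js (\<lambda>A. c A - c' A) A = boundary X js c A - boundary X js c' A"
  using boundary_add[of js c "\<lambda>A. - c' A" A] by (simp add: boundary_uminus)

end

text \<open>The instance \<open>N = UNIV\<close> of functoriality, for maps that are additive
  everywhere.\<close>

lemma (in commuting_endos) boundary_endo: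
  assumes "\<And>u v. h (u + v) = h u + h v"
    and "\<And>j v. j \<in> set js \<Longrightarrow> h (X j v) = X j (h v)"
  shows "boundary X js (\<lambda>A. h (c A)) A = h (boundary X js c A)"
proof -
  interpret U: commuting_endos UNIV X
    by standard (simp_all add: X_add X_X)
  show ?thesis
    using U.boundary_hom[of h js c] assms by simp
qed

context commuting_endos
begin

text \<open>The only cross terms are \<open>X j\<close> of the boundary of the \<open>True\<close>
  half and the boundary of \<open>X j\<close> applied to that half. They have opposite signs and
  agree because the operators commute.\<close>

lemma boundary_boundary: "boundary X js (boundary X js c) A = 0"
proof (induction js arbitrary: c A)
  case (Cons j js)
  have *: "boundary X js (\<lambda>B. X j (c (True # B))) A' = X j (boundary X js (\<lambda>B. c (True # B)) A')" for A'
    by (rule boundary_endo) (simp_all add: X_add X_X)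
  show ?case
    by (auto simp: boundary_uminus boundary_add Cons.IH * X_uminus split: list.split)
qed simp

lemma boundary_support:
  assumes "\<And>A. c A \<noteq> 0 \<Longrightarrow> length A = length js \<and> count_list A True = i"
    and "boundary X js c A \<noteq> 0"
  shows "length A = length js \<and> Suc (count_list A True) = i"
  using assms
proof (induction js arbitrary: c A i)
  case (Cons j js)
  then obtain a A' where A: "A = a # A'"
    by (cases A) auto
  show ?case
  proof (cases a)
    case True
    have "\<exists>B. c (True # B) \<noteq> 0"
    proof (rule ccontr)
      assume "\<nexists>B. c (True # B) \<noteq> 0"
      then have "(\<lambda>B. c (True # B)) = (\<lambda>_. 0)"
        by auto
      then show False
        using Cons.prems(2) A True by simp
    qed
    then have "i \<noteq> 0"
      using Cons.prems(1)[of "True # _"] by auto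
    moreover have "length A' = length js \<and> Suc (count_list A' True) = i - 1"
      by (rule Cons.IH[of "\<lambda>B. c (True # B)"])
        (use Cons.prems(1)[of "True # _"] Cons.prems(2) A True in \<open>fastforce+\<close>)
    ultimately show ?thesis
      using A True by auto
  next
    case False
    show ?thesis
    proof (cases "c (True # A') = 0")
      case True
      have "length A' = length js \<and> Suc (count_list A' True) = i"
        by (rule Cons.IH[of "\<lambda>B. c (False # B)"])
          (use Cons.prems(1)[of "False # _"] Cons.prems(2) A True False in auto)
      then show ?thesis
        using A False by auto
    qed (use Cons.prems(1)[of "True # A'"] A False in auto)
  qed
qed simp

lemma boundary_chains:
  assumes "c \<in> chains (length js) (Suc i) N"
  shows "boundary X js c \<in> chains (length js) i N"
  using boundary_support[of c js "Suc i"] boundary_mem[of c js] assms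
  unfolding chains_def by blast

lemma boundary_chains_0:
  assumes "c \<in> chains (length js) 0 N"
  shows "boundary X js c A = 0"
  using boundary_support[of c js 0] assms unfolding chains_def by blast

end

text \<open>A constructive form of a regular sequence: \<open>L j\<close> splits \<open>X j\<close>
  and commutes with the other operators, so every \<open>X j\<close> stays injective modulo the
  images of the others.\<close>

locale split_endos = commuting_endos N X
  for N :: "'a::ab_group_add set" and X :: "'j \<Rightarrow> 'a \<Rightarrow> 'a" +
  fixes L :: "'j \<Rightarrow> 'a \<Rightarrow> 'a"
  assumes L_mem: "v \<in> N \<Longrightarrow> L j v \<in> N"
    and L_add: "L j (u + v) = L j u + L j v"
    and L_X: "L j (X j v) = v"
    and L_X_commute: "i \<noteq> j \<Longrightarrow> L i (X j v) = X j (L i v)"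
begin

text \<open>\<open>retract j\<close> is the projection onto the kernel of \<open>L j\<close> along the image of \<open>X j\<close>, so \<open>residue js\<close>
  computes the class modulo the images of all operators in \<open>js\<close>.\<close>

definition retract :: "'j \<Rightarrow> 'a \<Rightarrow> 'a" where
  "retract j v = v - X j (L j v)"

definition residue :: "'j list \<Rightarrow> 'a \<Rightarrow> 'a" where
  "residue js = fold retract js"

lemma residue_simps [simp]:
  "residue [] v = v" "residue (j # js) v = residue js (retract j v)"
  by (simp_all add: residue_def)

lemma retract_mem: "v \<in> N \<Longrightarrow> retract j v \<in> N"
  by (simp add: retract_def diff_mem X_mem L_mem)

lemma residue_mem: "v \<in> N \<Longrightarrow> residue js v \<in> N"
  by (induction js arbitrary: v) (simp_all add: retract_mem)

lemma retract_add: "retract j (u + v) = retract j u + retract j v"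
  by (simp add: retract_def L_add X_add)

lemma residue_add: "residue js (u + v) = residue js u + residue js v"
  by (induction js arbitrary: u v) (simp_all add: retract_add)

lemma residue_0 [simp]: "residue js 0 = 0"
  using residue_add[of js 0 0] by simp

lemma retract_0: "retract j 0 = 0"
  using retract_add[of j 0 0] by simp

lemma residue_uminus: "residue js (- v) = - residue js v"
  using residue_add[of js v "- v"] by (simp add: add_eq_0_iff)

lemma retract_X: "retract j (X j v) = 0"
  by (simp add: retract_def L_X)

lemma retract_X_commute: "i \<noteq> j \<Longrightarrow> retract i (X j v) = X j (retract i v)"
  by (simp add: retract_def L_X_commute X_diff X_X)

lemma residue_X_commute: "j \<notin> set js \<Longrightarrow> residue js (X j v) = X j (residue js v)"
  by (induction js arbitrary: v) (auto simp: retract_X_commute)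

lemma X_eq_0D: "X j v = 0 \<Longrightarrow> v = 0"
  using L_X[of j v] L_add[of j 0 0] by simp

text \<open>In degree 0 a boundary is a sum of elements \<open>X j v\<close>. The first retraction
  removes the summand of the head operator and commutes with the remaining operators, so it passes
  into the chain and induction applies.\<close>

lemma residue_boundary:
  assumes "distinct js"
  shows "residue js (boundary X js c (replicate (length js) False)) = 0"
  using assms
proof (induction js arbitrary: c)
  case (Cons j js)
  define F where "F = replicate (length js) False"
  have "retract j (boundary X js (\<lambda>B. c (False # B)) F)
      = boundary X js (\<lambda>B. retract j (c (False # B))) F"
    by (rule boundary_endo[symmetric])
      (use Cons.prems in \<open>auto simp: retract_add intro!: retract_X_commute\<close>)
  then show ?case
    using Cons by (simp add: retract_add retract_X F_def)
qed simp

text \<open>The converse in degree 0. In \<open>v = retract j v + X j (L j v)\<close> the second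
  summand is the boundary of \<open>L j v\<close> placed at the singleton of \<open>j\<close>; the
  first has residue 0 for the tail and is handled by induction.\<close>

lemma residue_eq_0_imp_boundary:
  assumes "distinct js" "v \<in> N" "residue js v = 0"
  shows "\<exists>b\<in>chains (length js) 1 N.
           boundary X js b = (\<lambda>A. if A = replicate (length js) False then v else 0)"
  using assms
proof (induction js arbitrary: v)
  case Nil
  then show ?case
    by (intro bexI[of _ "\<lambda>_. 0"]) (auto simp: chains_def zero_mem)
next
  case (Cons j js)
  have "\<exists>b\<in>chains (length js) 1 N.
      boundary X js b = (\<lambda>A. if A = replicate (length js) False then retract j v else 0)"
    using Cons by (simp add: retract_mem)
  then obtain b where b: "b \<in> chains (length js) 1 N"
    "boundary X js b = (\<lambda>A. if A = replicate (length js) False then retract j v else 0)"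
    by blast
  define b1 where "b1 = (\<lambda>A. if A = replicate (length js) False then L j v else 0)"
  have b1: "b1 \<in> chains (length js) 0 N"
    using Cons.prems by (auto simp: b1_def chains_def L_mem zero_mem)
  then have b1': "boundary X js b1 A = 0" for A
    by (rule boundary_chains_0)
  have b1_eq: "b1 (replicate (length js) False) = L j v"
    "A \<noteq> replicate (length js) False \<Longrightarrow> b1 A = 0" for A
    by (simp_all add: b1_def)
  have "join b b1 \<in> chains (length (j # js)) 1 N"
    using b(1) b1 by (auto simp: chains_def join_def zero_mem split: list.splits if_splits)
  moreover have "boundary X (j # js) (join b b1) A
      = (if A = replicate (length (j # js)) False then v else 0)" for A
    by (auto simp: b b1' b1_eq retract_def split: list.splits)
  ultimately show ?case
    by blast
qed

text \<open>Induction along the mapping cone. For a cycle with halves \<open>c0\<close> and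
  \<open>c1\<close>, first write \<open>c1\<close> as the boundary of \<open>b1\<close>; then
  \<open>X j b1 + c0\<close> is a cycle, say the boundary of \<open>b0\<close>, and
  \<open>b0\<close> and \<open>- b1\<close> are the halves of the chain sought.\<close>

theorem boundary_exact:
  assumes "distinct js" "c \<in> chains (length js) (Suc i) N" "\<And>A. boundary X js c A = 0"
  shows "\<exists>b\<in>chains (length js) (Suc (Suc i)) N. boundary X js b = c"
  using assms
proof (induction js arbitrary: c i)
  case Nil
  then have "c = (\<lambda>_. 0)"
    using chains_too_big[of c 0 "Suc i" N] by auto
  then show ?case
    by (intro bexI[of _ "\<lambda>_. 0"]) (auto simp: chains_def zero_mem)
next
  case (Cons j js)
  define c0 where "c0 = (\<lambda>A. c (False # A))"
  define c1 where "c1 = (\<lambda>A. c (True # A))"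
  define F where "F = replicate (length js) False"
  have c0: "c0 \<in> chains (length js) (Suc i) N" and c1: "c1 \<in> chains (length js) i N"
    using Cons.prems(2) chains_False chains_True unfolding c0_def c1_def by fastforce+
  have d1: "boundary X js c1 A = 0" for A
    using Cons.prems(3)[of "True # A"] by (simp add: c1_def)
  have d0: "X j (c1 A) + boundary X js c0 A = 0" for A
    using Cons.prems(3)[of "False # A"] by (simp add: c0_def c1_def)
  have "\<exists>b1\<in>chains (length js) (Suc i) N. boundary X js b1 = c1"
  proof (cases i)
    \<comment> \<open>Here \<open>c1\<close> has degree 0, where being a cycle says nothing. Instead
      \<open>X j c1\<close> is a boundary, so its residue vanishes; the residue commutes with
      \<open>X j\<close>, which is injective.\<close>
    case 0
    have "X j (c1 F) = - boundary X js c0 F"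
      using d0 by (simp add: eq_neg_iff_add_eq_0)
    then have "X j (residue js (c1 F)) = - residue js (boundary X js c0 F)"
      using Cons.prems(1) by (metis residue_X_commute residue_uminus distinct.simps(2))
    also have "\<dots> = 0"
      using residue_boundary[of js c0] Cons.prems(1) by (simp add: F_def)
    finally have "residue js (c1 F) = 0"
      by (rule X_eq_0D)
    then have "\<exists>b1\<in>chains (length js) 1 N. boundary X js b1 = (\<lambda>A. if A = F then c1 F else 0)"
      using residue_eq_0_imp_boundary[of js "c1 F"] Cons.prems(1) chains_mem[OF c1]
      by (simp add: F_def)
    moreover have "(\<lambda>A. if A = F then c1 F else 0) = c1"
      using c1 0 count_list_True_0 by (fastforce simp: chains_def F_def)
    ultimately show ?thesis
      using 0 by simp
  next
    case (Suc i')
    then show ?thesis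
      using Cons.IH[of c1 i'] c1 d1 Cons.prems(1) by simp
  qed
  then obtain b1 where b1: "b1 \<in> chains (length js) (Suc i) N" "boundary X js b1 = c1"
    by blast
  define e where "e = (\<lambda>A. X j (b1 A) + c0 A)"
  have Xb1: "boundary X js (\<lambda>A. X j (b1 A)) A = X j (c1 A)" for A
    by (subst boundary_endo) (simp_all add: X_add X_X b1)
  have "e \<in> chains (length js) (Suc i) N"
    using b1(1) c0 by (auto simp: chains_def e_def add_mem X_mem) (metis X_0 add_0)+
  moreover have "boundary X js e A = 0" for A
    by (simp add: e_def boundary_add Xb1 d0)
  ultimately obtain b0 where b0: "b0 \<in> chains (length js) (Suc (Suc i)) N" "boundary X js b0 = e"
    using Cons.IH[of e i] Cons.prems(1) by auto
  have "join b0 (\<lambda>A. - b1 A) \<in> chains (length (j # js)) (Suc (Suc i)) N"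
    using b0(1) b1(1)
    by (auto simp: chains_def join_def zero_mem uminus_mem split: list.splits if_splits)
  moreover have "boundary X (j # js) (join b0 (\<lambda>A. - b1 A)) A = c A" for A
  proof (cases A)
    case Nil
    then show ?thesis
      using Cons.prems(2) by (auto simp: chains_def)
  qed (auto simp: b0 b1 boundary_uminus e_def X_uminus c0_def c1_def)
  ultimately show ?case
    by blast
qed

end

text \<open>The model is a free module over the polynomial ring: \<open>x j\<close> multiplies by a
  variable, \<open>D j\<close> divides by it and drops the indivisible terms, and \<open>T j\<close>
  acts on the basis. \<open>T = 0\<close> gives the Koszul complex of the variables; truncated
  multiplication of basis monomials gives the resolution.\<close>

locale shifted_endos =
  fixes N :: "'a::ab_group_add set" and x D T :: "'j \<Rightarrow> 'a \<Rightarrow> 'a"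
  assumes zero_mem: "0 \<in> N"
    and add_mem: "u \<in> N \<Longrightarrow> v \<in> N \<Longrightarrow> u + v \<in> N"
    and uminus_mem: "v \<in> N \<Longrightarrow> - v \<in> N"
    and x_mem: "v \<in> N \<Longrightarrow> x j v \<in> N"
    and D_mem: "v \<in> N \<Longrightarrow> D j v \<in> N"
    and T_mem: "v \<in> N \<Longrightarrow> T j v \<in> N"
    and x_add: "x j (u + v) = x j u + x j v"
    and D_add: "D j (u + v) = D j u + D j v"
    and T_add: "T j (u + v) = T j u + T j v"
    and x_x: "x i (x j v) = x j (x i v)"
    and T_T: "T i (T j v) = T j (T i v)"
    and T_x: "T i (x j v) = x j (T i v)"
    and T_D: "T i (D j v) = D j (T i v)"
    and D_D: "D i (D j v) = D j (D i v)"
    and D_x: "D j (x j v) = v"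
    and D_x_commute: "i \<noteq> j \<Longrightarrow> D i (x j v) = x j (D i v)"
    and D_nilpotent: "\<exists>K. (D j ^^ K) v = 0"
begin

definition X :: "'j \<Rightarrow> 'a \<Rightarrow> 'a" where
  "X j v = x j v - T j v"

text \<open>Since \<open>D j\<close> divides by \<open>x j\<close>, \<open>D j \<circ> X j = 1 - T j \<circ> D j\<close> is invertible and
  \<open>(D j \<circ> X j)\<inverse> \<circ> D j\<close> is a left inverse of \<open>X j\<close>.\<close>

definition L :: "'j \<Rightarrow> 'a \<Rightarrow> 'a" where
  "L j v = (THE y. y - T j (D j y) = D j v)"

lemma zeros [simp]: "x j 0 = 0" "D j 0 = 0" "T j 0 = 0"
  using x_add[of j 0 0] D_add[of j 0 0] T_add[of j 0 0] by simp_all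

lemma uminus: "x j (- v) = - x j v" "D j (- v) = - D j v" "T j (- v) = - T j v"
  using x_add[of j v "- v"] D_add[of j v "- v"] T_add[of j v "- v"] by (simp_all add: add_eq_0_iff)

lemma diff: "x j (u - v) = x j u - x j v" "D j (u - v) = D j u - D j v" "T j (u - v) = T j u - T j v"
  using x_add[of j u "- v"] D_add[of j u "- v"] T_add[of j u "- v"] by (simp_all add: uminus)

lemma TD_power_0: "(D j ^^ K) v = 0 \<Longrightarrow> ((\<lambda>u. T j (D j u)) ^^ K) v = 0"
proof -
  have "((\<lambda>u. T j (D j u)) ^^ K) v = (T j ^^ K) ((D j ^^ K) v)" for v
  proof (induction K arbitrary: v)
    case (Suc K)
    have "D j ((T j ^^ K) u) = (T j ^^ K) (D j u)" for u
      by (induction K) (simp_all flip: T_D)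
    then show ?case
      using Suc by simp
  qed simp
  moreover have "(T j ^^ K) 0 = 0"
    by (induction K) simp_all
  ultimately show "(D j ^^ K) v = 0 \<Longrightarrow> ?thesis"
    by simp
qed

lemma fixed_TD: "y = T j (D j y) \<Longrightarrow> y = 0"
proof -
  assume y: "y = T j (D j y)"
  have "((\<lambda>u. T j (D j u)) ^^ K) y = y" for K
    by (induction K) (simp_all flip: y)
  then show ?thesis
    using TD_power_0 D_nilpotent by metis
qed

text \<open>The solution is the geometric series of \<open>T j \<circ> D j\<close> at
  \<open>w\<close>, finite by nilpotency. Membership is an implication because \<open>L\<close> is
  defined on the whole type and must also preserve \<open>N\<close>.\<close>

lemma solve_TD: "\<exists>y. y - T j (D j y) = w \<and> (w \<in> N \<longrightarrow> y \<in> N)"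
proof -
  obtain K where "(D j ^^ K) w = 0"
    using D_nilpotent by blast
  then have "((\<lambda>u. T j (D j u)) ^^ K) w = 0"
    by (rule TD_power_0)
  then show ?thesis
  proof (induction K arbitrary: w)
    case 0
    then show ?case using zero_mem by (intro exI[of _ 0]) auto
  next
    case (Suc K)
    obtain y where y: "y - T j (D j y) = T j (D j w)" "T j (D j w) \<in> N \<longrightarrow> y \<in> N"
      using Suc.IH[of "T j (D j w)"] Suc.prems
      by (auto simp: funpow_Suc_right simp del: funpow.simps)
    show ?case
      using y by (intro exI[of _ "w + y"]) (auto simp: D_add T_add D_mem T_mem add_mem algebra_simps)
  qed
qed

lemma L_eqI: "y - T j (D j y) = D j v \<Longrightarrow> L j v = y"
  unfolding L_def
proof (rule the_equality)
  fix z assume "y - T j (D j y) = D j v" "z - T j (D j z) = D j v"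
  then have "y = D j v + T j (D j y)" "z = D j v + T j (D j z)"
    by (simp_all add: diff_eq_eq)
  then have "z - y = T j (D j (z - y))"
    unfolding diff by (metis add_diff_cancel_left)
  then show "z = y"
    using fixed_TD by fastforce
qed

lemma L_eq: "L j v - T j (D j (L j v)) = D j v"
  using solve_TD[of j "D j v"] L_eqI by metis

lemma D_X: "D j (X j v) = v - T j (D j v)"
  by (simp add: X_def diff D_x T_D)

lemma D_retract: "D j (v - X j (L j v)) = 0"
  by (simp add: diff D_X L_eq)

lemma X_D_commute: "i \<noteq> j \<Longrightarrow> D i (X j v) = X j (D i v)"
  by (simp add: X_def diff D_x_commute T_D)

lemma L_D_commute: "D i (L j v) = L j (D i v)"
  using L_eq[of j v] by (intro L_eqI[symmetric]) (metis D_D T_D diff(2))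

lemma split_endos: "split_endos N X L"
proof
  show "L j v \<in> N" if "v \<in> N" for j v
    using solve_TD[of j "D j v"] L_eqI D_mem[OF that] by metis
  show "L j (u + v) = L j u + L j v" for j u v
    by (rule L_eqI) (simp only: D_add T_add add_diff_add L_eq)
  show "L j (X j v) = v" for j v
    by (rule L_eqI) (simp add: D_X)
  show "L i (X j v) = X j (L i v)" if "i \<noteq> j" for i j v
  proof (rule L_eqI)
    have "X j (L i v) - T i (D i (X j (L i v))) = X j (L i v - T i (D i (L i v)))"
      by (simp add: X_D_commute that) (simp add: X_def diff T_x T_T)
    then show "X j (L i v) - T i (D i (X j (L i v))) = D i (X j v)"
      by (simp add: L_eq X_D_commute that)
  qed
  show "X j v \<in> N" if "v \<in> N" for j v
    unfolding X_def diff_conv_add_uminus by (intro add_mem uminus_mem x_mem T_mem that)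
  show "X i (X j v) = X j (X i v)" for i j v
    by (simp add: X_def diff x_x T_x T_T algebra_simps)
qed (auto simp: zero_mem add_mem uminus_mem X_def x_add T_add)

end

sublocale shifted_endos \<subseteq> split_endos N X L
  by (rule split_endos)

text \<open>\<open>L\<close> is made so that \<open>D j\<close> kills the values of
  \<open>retract j\<close>, and the retractions for other indices commute with \<open>D j\<close>.
  In the model, residues thus have coefficients in the field.\<close>

lemma (in shifted_endos) D_residue:
  assumes "distinct js" "j \<in> set js"
  shows "D j (residue js v) = 0"
proof -
  have comm: "D j (retract i v) = retract i (D j v)" if "i \<noteq> j" for i v
    using that by (simp add: retract_def diff X_D_commute L_D_commute)
  have 0: "D j (residue js v) = 0" if "j \<notin> set js" "D j v = 0" for js v
    using that by (induction js arbitrary: v) (auto simp: comm retract_0)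
  show ?thesis
    using assms
  proof (induction js arbitrary: v)
    case (Cons i js)
    then show ?case
      using 0[of js "retract i v"] by (auto simp: retract_def D_retract)
  qed simp
qed

section \<open>Operators on free modules over the polynomial ring\<close>

lemma poly_mapping_add_induct [case_names zero single add]:
  fixes v :: "'b \<Rightarrow>\<^sub>0 'a::comm_monoid_add"
  assumes "P 0" "\<And>b f. P (Poly_Mapping.single b f)" "\<And>u v. P u \<Longrightarrow> P v \<Longrightarrow> P (u + v)"
  shows "P v"
proof (induction v rule: update_induct)
  case const
  then show ?case by (rule assms(1))
next
  case (update f a b)
  then have "Poly_Mapping.update a b f = f + Poly_Mapping.single a b"
    by (intro poly_mapping_eqI) (auto simp: lookup_update lookup_add lookup_single in_keys_iff)
  then show ?case
    using assms update by simp
qed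

section \<open>Monomials, and multiplication and division by a variable\<close>

lemma monom_minus_add:
  "Poly_Mapping.lookup u j \<noteq> 0 \<Longrightarrow> u - Poly_Mapping.single j 1 + Poly_Mapping.single j 1 = (u :: 'n monom)"
  by (rule poly_mapping_eqI) (auto simp: lookup_add lookup_minus lookup_single when_def)

lemma monom_eq_add_single:
  "a = u + Poly_Mapping.single j 1 \<longleftrightarrow> Poly_Mapping.lookup (a :: 'n monom) j \<noteq> 0 \<and> a - Poly_Mapping.single j 1 = u"
  by (metis monom_minus_add add_diff_cancel_right' lookup_add lookup_single_eq add_is_0 one_neq_zero)

text \<open>The coefficient ring is arbitrary because the formula serves twice: for polynomials over
  a field, and for elements of a free module with monomial basis, read as polynomials with
  polynomial coefficients.\<close>

lemma lookup_single_mult: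
  fixes f :: "('n monom \<Rightarrow>\<^sub>0 'a::comm_ring_1)"
  shows "Poly_Mapping.lookup (Poly_Mapping.single (Poly_Mapping.single j 1) 1 * f) u =
     (if Poly_Mapping.lookup u j = 0 then 0
      else Poly_Mapping.lookup f (u - Poly_Mapping.single j 1))"
proof (induction f rule: poly_mapping_add_induct)
  case (single b f)
  have "u = Poly_Mapping.single j 1 + b \<longleftrightarrow>
      Poly_Mapping.lookup u j \<noteq> 0 \<and> u - Poly_Mapping.single j 1 = b"
    using monom_eq_add_single[of u b j] by (simp add: add.commute)
  then show ?case
    by (auto simp: mult_single lookup_single when_def)
qed (auto simp: distrib_left lookup_add)

definition var :: "'n \<Rightarrow> ('n::finite, 'k::field) mpoly" where
  "var j = Poly_Mapping.single (Poly_Mapping.single j 1) 1"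

text \<open>The terms of \<open>f\<close> that are not divisible by the variable are dropped.\<close>

definition var_div :: "'n \<Rightarrow> ('n::finite, 'k::field) mpoly \<Rightarrow> ('n, 'k) mpoly" where
  "var_div j f = Poly_Mapping.map_key (\<lambda>u. u + Poly_Mapping.single j 1) f"

lemma lookup_var_mult:
  "Poly_Mapping.lookup (var j * f) u =
     (if Poly_Mapping.lookup u j = 0 then 0
      else Poly_Mapping.lookup f (u - Poly_Mapping.single j 1))"
  unfolding var_def by (rule lookup_single_mult)

lemma lookup_var_div:
  fixes f :: "('n::finite, 'k::field) mpoly"
  shows "Poly_Mapping.lookup (var_div j f) u = Poly_Mapping.lookup f (u + Poly_Mapping.single j 1)"
proof -
  have "inj (\<lambda>u :: 'n monom. u + Poly_Mapping.single j 1)"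
    by (simp add: inj_def)
  then show ?thesis
    by (simp add: var_div_def map_key.rep_eq)
qed

lemma var_div_add: "var_div j (f + g) = var_div j f + var_div j g"
  by (rule poly_mapping_eqI) (simp add: lookup_var_div lookup_add)

lemma var_div_0 [simp]: "var_div j 0 = 0"
  by (rule poly_mapping_eqI) (simp add: lookup_var_div)

lemma var_div_var: "var_div j (var j * f) = f"
  by (rule poly_mapping_eqI) (simp add: lookup_var_div lookup_var_mult lookup_add)

lemma var_div_var_commute:
  fixes f :: "('n::finite, 'k::field) mpoly"
  shows "i \<noteq> j \<Longrightarrow> var_div i (var j * f) = var j * var_div i f"
proof (rule poly_mapping_eqI)
  fix u :: "'n monom"
  assume "i \<noteq> j"
  moreover have "u + Poly_Mapping.single i 1 - Poly_Mapping.single j 1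
      = u - Poly_Mapping.single j 1 + Poly_Mapping.single i 1"
    if "Poly_Mapping.lookup u j \<noteq> 0"
    using that \<open>i \<noteq> j\<close>
    by (intro poly_mapping_eqI) (auto simp: lookup_add lookup_minus lookup_single when_def)
  ultimately show "Poly_Mapping.lookup (var_div i (var j * f)) u =
      Poly_Mapping.lookup (var j * var_div i f) u"
    by (auto simp: lookup_var_div lookup_var_mult lookup_add lookup_single)
qed

lemma var_div_commute: "var_div i (var_div j f) = var_div j (var_div i f)"
  by (rule poly_mapping_eqI) (simp add: lookup_var_div ac_simps)

lemma lookup_scale [simp]: "Poly_Mapping.lookup (scale r v) b = r * Poly_Mapping.lookup v b"
  by (auto simp: scale_def map.rep_eq when_def)

lemma lookup_map: "f 0 = 0 \<Longrightarrow> Poly_Mapping.lookup (Poly_Mapping.map f v) b = f (Poly_Mapping.lookup v b)"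
  by (auto simp: map.rep_eq when_def)

lemma scale_add: "scale r (u + v) = scale r u + scale r v"
  by (rule poly_mapping_eqI) (simp add: lookup_add distrib_left)

lemma scale_scale: "scale r (scale s v) = scale s (scale r v)"
  by (rule poly_mapping_eqI) (simp add: ac_simps)

lemma free_mod_iff: "v \<in> free_mod B \<longleftrightarrow> (\<forall>b. b \<notin> B \<longrightarrow> Poly_Mapping.lookup v b = 0)"
  by (auto simp: free_mod_def in_keys_iff)

lemma scale_mem: "v \<in> free_mod B \<Longrightarrow> scale r v \<in> free_mod B"
  by (simp add: free_mod_iff)

text \<open>Each application raises by one the exponent at which coefficients are read, and only
  finitely many monomials occur in \<open>v\<close>. The bound depends on \<open>v\<close>.\<close>

lemma map_var_div_nilpotent:
  fixes v :: "'b \<Rightarrow>\<^sub>0 ('n::finite, 'k::field) mpoly"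
  shows "\<exists>K. (Poly_Mapping.map (var_div j) ^^ K) v = 0"
proof -
  have iter: "Poly_Mapping.lookup (Poly_Mapping.lookup ((Poly_Mapping.map (var_div j) ^^ K) v) b) u
      = Poly_Mapping.lookup (Poly_Mapping.lookup v b) (u + Poly_Mapping.single j K)" for K b u
  proof (induction K arbitrary: u)
    case (Suc K)
    have "u + Poly_Mapping.single j (Suc 0) + Poly_Mapping.single j K = u + Poly_Mapping.single j (Suc K)"
      by (simp add: add.assoc flip: single_add)
    then show ?case
      using Suc by (simp add: lookup_map lookup_var_div)
  qed simp
  define U where "U = (\<Union>b\<in>Poly_Mapping.keys v. Poly_Mapping.keys (Poly_Mapping.lookup v b))"
  \<comment> \<open>A sum dominates each of its terms and covers the case that \<open>U\<close> is
    empty; \<open>Suc\<close> makes the bound strict.\<close>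
  define K where "K = Suc (\<Sum>u\<in>U. Poly_Mapping.lookup u j)"
  have "finite U"
    by (simp add: U_def)
  have "Poly_Mapping.lookup (Poly_Mapping.lookup v b) (u + Poly_Mapping.single j K) = 0" for b u
  proof (rule ccontr)
    assume *: "Poly_Mapping.lookup (Poly_Mapping.lookup v b) (u + Poly_Mapping.single j K) \<noteq> 0"
    then have "u + Poly_Mapping.single j K \<in> U"
      by (auto simp: U_def in_keys_iff intro!: bexI[of _ b])
    then have "Poly_Mapping.lookup (u + Poly_Mapping.single j K) j \<le> (\<Sum>u\<in>U. Poly_Mapping.lookup u j)"
      using \<open>finite U\<close> member_le_sum[of _ U "\<lambda>u. Poly_Mapping.lookup u j"] by blast
    then show False
      by (simp add: lookup_add K_def)
  qed
  then have "(Poly_Mapping.map (var_div j) ^^ K) v = 0"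
    by (intro poly_mapping_eqI) (simp add: iter)
  then show ?thesis ..
qed

lemma shifted_endos_free_mod:
  fixes T :: "'n::finite \<Rightarrow> ('b \<Rightarrow>\<^sub>0 ('n, 'k::field) mpoly) \<Rightarrow> ('b \<Rightarrow>\<^sub>0 ('n, 'k) mpoly)"
  assumes "\<And>j v. v \<in> free_mod B \<Longrightarrow> T j v \<in> free_mod B"
    and "\<And>j u v. T j (u + v) = T j u + T j v"
    and "\<And>i j v. T i (T j v) = T j (T i v)"
    and "\<And>i j v. T i (scale (var j) v) = scale (var j) (T i v)"
    and "\<And>i j v. T i (Poly_Mapping.map (var_div j) v) = Poly_Mapping.map (var_div j) (T i v)"
  shows "shifted_endos (free_mod B) (\<lambda>j. scale (var j)) (\<lambda>j. Poly_Mapping.map (var_div j)) T"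
proof
  show "Poly_Mapping.map (var_div j) (u + v) = Poly_Mapping.map (var_div j) u + Poly_Mapping.map (var_div j) v"
    for j and u v :: "'b \<Rightarrow>\<^sub>0 ('n, 'k) mpoly"
    by (rule poly_mapping_eqI) (simp add: lookup_map lookup_add var_div_add)
  show "Poly_Mapping.map (var_div i) (Poly_Mapping.map (var_div j) v)
      = Poly_Mapping.map (var_div j) (Poly_Mapping.map (var_div i) v)"
    for i j and v :: "'b \<Rightarrow>\<^sub>0 ('n, 'k) mpoly"
    by (rule poly_mapping_eqI) (simp add: lookup_map var_div_commute)
  show "Poly_Mapping.map (var_div j) (scale (var j) v) = v" for j and v :: "'b \<Rightarrow>\<^sub>0 ('n, 'k) mpoly"
    by (rule poly_mapping_eqI) (simp add: lookup_map var_div_var)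
  show "Poly_Mapping.map (var_div i) (scale (var j) v) = scale (var j) (Poly_Mapping.map (var_div i) v)"
    if "i \<noteq> j" for i j and v :: "'b \<Rightarrow>\<^sub>0 ('n, 'k) mpoly"
    by (rule poly_mapping_eqI) (simp add: lookup_map var_div_var_commute that)
  show "scale (var i) (scale (var j) v) = scale (var j) (scale (var i) v)"
    for i j and v :: "'b \<Rightarrow>\<^sub>0 ('n, 'k) mpoly"
    by (rule scale_scale)
  show "\<exists>K. (Poly_Mapping.map (var_div j) ^^ K) v = 0" for j and v :: "'b \<Rightarrow>\<^sub>0 ('n, 'k) mpoly"
    by (rule map_var_div_nilpotent)
  show "scale (var j) (u + v) = scale (var j) u + scale (var j) v"
    for j and u v :: "'b \<Rightarrow>\<^sub>0 ('n, 'k) mpoly"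
    by (rule scale_add)
qed (fact assms | simp add: free_mod_iff lookup_add lookup_map)+

text \<open>The case \<open>T = 0\<close>, where \<open>X j\<close> is multiplication by the
  variable itself. The left inverse stays anonymous: exactness is what it is for.\<close>

lemma split_endos_var:
  fixes B :: "'b set"
  shows "\<exists>L. split_endos (free_mod B) (\<lambda>j :: 'n::finite. scale (var j :: ('n, 'k::field) mpoly)) L"
proof -
  have "shifted_endos (free_mod B) (\<lambda>j :: 'n. scale (var j :: ('n, 'k) mpoly))
      (\<lambda>j. Poly_Mapping.map (var_div j)) (\<lambda>_ _. 0)"
  proof (rule shifted_endos_free_mod)
    fix i j and v :: "'b \<Rightarrow>\<^sub>0 ('n, 'k) mpoly"
    show "0 = scale (var j :: ('n, 'k) mpoly) (0 :: 'b \<Rightarrow>\<^sub>0 ('n, 'k) mpoly)"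
      by (rule poly_mapping_eqI) simp
    show "0 = Poly_Mapping.map (var_div j) (0 :: 'b \<Rightarrow>\<^sub>0 ('n, 'k) mpoly)"
      by (rule poly_mapping_eqI) (simp add: lookup_map)
    show "(0 :: 'b \<Rightarrow>\<^sub>0 ('n, 'k) mpoly) \<in> free_mod B"
      by (simp add: free_mod_iff)
    show "(0 :: 'b \<Rightarrow>\<^sub>0 ('n, 'k) mpoly) = 0 + 0" by simp
  qed (rule refl)
  then interpret S: shifted_endos "free_mod B" "\<lambda>j :: 'n. scale (var j :: ('n, 'k) mpoly)"
    "\<lambda>j. Poly_Mapping.map (var_div j)" "\<lambda>_ _. 0" .
  have "S.X = (\<lambda>j. scale (var j))"
    unfolding S.X_def by (rule ext)+ (rule diff_zero)
  then show ?thesis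
    using S.split_endos by metis
qed

section \<open>Lower bound for the length of a resolution\<close>

lemma hom_on_0:
  assumes "hom_on B (free_mod C) (+) scale f"
  shows "f 0 = 0"
proof -
  have "0 \<in> free_mod B"
    by (simp add: free_mod_def)
  then have "f (0 + 0) = f 0 + f 0"
    using assms unfolding hom_on_def by blast
  then show ?thesis by simp
qed

lemma hom_on_mem: "hom_on B N a s f \<Longrightarrow> v \<in> free_mod B \<Longrightarrow> f v \<in> N"
  unfolding hom_on_def by blast

lemma hom_on_add:
  "hom_on B N a s f \<Longrightarrow> u \<in> free_mod B \<Longrightarrow> v \<in> free_mod B \<Longrightarrow> f (u + v) = a (f u) (f v)"
  unfolding hom_on_def by blast

lemma hom_on_scale: "hom_on B N a s f \<Longrightarrow> v \<in> free_mod B \<Longrightarrow> f (scale r v) = s r (f v)"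
  unfolding hom_on_def by blast

lemma chains_map:
  assumes "c \<in> chains n i N" "\<And>v. v \<in> N \<Longrightarrow> f v \<in> N'" "f 0 = 0"
  shows "(\<lambda>A. f (c A)) \<in> chains n i N'"
proof -
  have "c A = 0" if "\<not> (length A = n \<and> count_list A True = i)" for A
    using assms(1) that by (auto simp: chains_def)
  then show ?thesis
    using assms unfolding chains_def by (intro CollectI allI conjI impI) (blast, metis, metis)
qed

lemma (in commuting_endos) chains_diff:
  assumes "c \<in> chains n i N" "c' \<in> chains n i N"
  shows "(\<lambda>A. c A - c' A) \<in> chains n i N"
proof -
  have "c A = 0" "c' A = 0" if "\<not> (length A = n \<and> count_list A True = i)" for A
    using assms that by (auto simp: chains_def)
  then show ?thesis
    using assms unfolding chains_def
    by (intro CollectI allI conjI impI diff_mem) (blast, blast, metis diff_self, metis diff_self)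
qed

text \<open>Diagram chase in the double complex of a resolution and the Koszul complex of the variables:
  the hypothesis \<open>i + m > l\<close> puts the anti-diagonal through \<open>c\<close> beyond the end of the resolution.\<close>

lemma resolution_chase:
  fixes J :: "('n::finite, 'k::field) mpoly set" and js :: "'n list"
  defines "\<delta> \<equiv> boundary (\<lambda>j. scale (var j)) js"
  assumes res: "free_resolution J l B d \<epsilon>" and js: "distinct js"
    and c: "c \<in> chains (length js) (Suc m) (free_mod (B i))"
    and c': "c' \<in> chains (length js) m (free_mod (B (Suc i)))"
    and eq: "\<And>A. \<delta> c A = d i (c' A)"
    and l: "l < i + Suc m"
  shows "\<exists>y\<in>chains (length js) (Suc (Suc m)) (free_mod (B i)).
         \<exists>e\<in>chains (length js) (Suc m) (free_mod (B (Suc i))). \<forall>A. c A = \<delta> y A + d i (e A)"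
  using c c' eq l
proof (induction "l - i" arbitrary: i m c c' rule: less_induct)
  case less
  note c = less.prems(1) and c' = less.prems(2) and eq = less.prems(3) and l = less.prems(4)
  let ?X = "\<lambda>j :: 'n. scale (var j :: ('n, 'k) mpoly)"
  have hom: "hom_on (B (Suc i)) (free_mod (B i)) (+) scale (d i)" for i
    using res by (simp add: free_resolution_def)
  have ker: "{v \<in> free_mod (B (Suc i)). d i v = 0} = d (Suc i) ` free_mod (B (Suc (Suc i)))"
    using res by (simp add: free_resolution_def)
  obtain L where "split_endos (free_mod (B i)) ?X L"
    using split_endos_var by blast
  then interpret F: split_endos "free_mod (B i)" ?X L .
  obtain L' where "split_endos (free_mod (B (Suc i))) ?X L'"
    using split_endos_var by blast
  then interpret F': split_endos "free_mod (B (Suc i))" ?X L' .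
  have d_\<delta>: "\<delta> (\<lambda>A. d i (e A)) A = d i (\<delta> e A)" if "\<And>A. e A \<in> free_mod (B (Suc i))" for e A
    unfolding \<delta>_def by (intro F'.boundary_hom that hom_on_add[OF hom] hom_on_scale[OF hom])
  show ?case
  proof (cases "l \<le> i")
    case True
    \<comment> \<open>At the end of the resolution \<open>c'\<close> takes values in the zero
      module, so \<open>c\<close> is a Koszul cycle and \<open>e = 0\<close> suffices.\<close>
    then have "B (Suc i) = {}"
      using res unfolding free_resolution_def by auto
    then have "c' A = 0" for A
      using chains_mem[OF c', of A] by (simp add: free_mod_def)
    then have "\<delta> c A = 0" for A
      using eq hom_on_0[OF hom] by simp
    then obtain y where y: "y \<in> chains (length js) (Suc (Suc m)) (free_mod (B i))" "\<delta> y = c"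
      using F.boundary_exact[OF js c] by (auto simp: \<delta>_def)
    show ?thesis
      using y hom_on_0[OF hom]
      by (intro bexI[OF _ y(1)] bexI[of _ "\<lambda>_. 0"]) (auto simp: chains_def F'.zero_mem)
  next
    case False
    then obtain m' where m: "m = Suc m'"
      using l by (cases m) auto
    have \<delta>c': "\<delta> c' \<in> chains (length js) m' (free_mod (B (Suc i)))"
      using F'.boundary_chains c' m by (simp add: \<delta>_def)
    have "d i (\<delta> c' A) = 0" for A
    proof -
      have "\<delta> (\<lambda>A. d i (c' A)) A = d i (\<delta> c' A)"
        by (rule d_\<delta>) (rule chains_mem[OF c'])
      moreover have "(\<lambda>A. d i (c' A)) = \<delta> c"
        by (simp add: eq fun_eq_iff)
      moreover have "\<delta> (\<delta> c) A = 0"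
        by (simp add: \<delta>_def F.boundary_boundary)
      ultimately show ?thesis
        by simp
    qed
    \<comment> \<open>Exactness of the resolution lifts the boundary of \<open>c'\<close> one step
      further, which gives the next pair on the same anti-diagonal.\<close>
    then have "\<delta> c' A \<in> d (Suc i) ` free_mod (B (Suc (Suc i)))" for A
      unfolding ker[symmetric] using chains_mem[OF \<delta>c'] by blast
    then have "\<exists>v\<in>free_mod (B (Suc (Suc i))). \<delta> c' A = d (Suc i) v" for A
      by blast
    then obtain g where g: "\<And>A. g A \<in> free_mod (B (Suc (Suc i)))" "\<And>A. \<delta> c' A = d (Suc i) (g A)"
      by metis
    \<comment> \<open>Arbitrary lifts need not vanish outside degree \<open>m'\<close>; the default
      0 makes them a chain.\<close>
    define c'' where "c'' = (\<lambda>A. if \<delta> c' A = 0 then 0 else g A)"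
    have "c'' \<in> chains (length js) m' (free_mod (B (Suc (Suc i))))"
      using \<delta>c' g(1) by (auto simp: chains_def c''_def free_mod_iff)
    moreover have "\<delta> c' A = d (Suc i) (c'' A)" for A
      using g(2) hom_on_0[OF hom] by (simp add: c''_def)
    moreover have "l - Suc i < l - i"
      using False by simp
    ultimately have "\<exists>y\<in>chains (length js) (Suc m) (free_mod (B (Suc i))).
        \<exists>e\<in>chains (length js) (Suc m') (free_mod (B (Suc (Suc i)))). \<forall>A. c' A = \<delta> y A + d (Suc i) (e A)"
      using less.hyps[of "Suc i" c' m' c''] c' l m by simp
    then obtain y' e' where
      y': "y' \<in> chains (length js) (Suc m) (free_mod (B (Suc i)))" and
      e': "e' \<in> chains (length js) (Suc m') (free_mod (B (Suc (Suc i))))" and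
      c'_eq: "\<And>A. c' A = \<delta> y' A + d (Suc i) (e' A)"
      by blast
    \<comment> \<open>Removing the image of \<open>y'\<close> turns \<open>c\<close> into a Koszul
      cycle: \<open>d i\<close> sends \<open>c'\<close> and the boundary of \<open>y'\<close> to the
      same element, as the rest of \<open>c'\<close> is in the image of
      \<open>d (Suc i)\<close>.\<close>
    define z where "z = (\<lambda>A. c A - d i (y' A))"
    have "d i (c' A) = d i (\<delta> y' A)" for A
    proof -
      have "\<delta> y' A \<in> free_mod (B (Suc i))"
        unfolding \<delta>_def by (rule F'.boundary_mem) (rule chains_mem[OF y'])
      moreover have "d (Suc i) (e' A) \<in> free_mod (B (Suc i))" "d i (d (Suc i) (e' A)) = 0"
        using imageI[OF chains_mem[OF e'], of "d (Suc i)"] unfolding ker[symmetric] by blast+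
      ultimately show ?thesis
        unfolding c'_eq[of A] using hom_on_add[OF hom[of i]] by simp
    qed
    moreover have "\<delta> z A = \<delta> c A - \<delta> (\<lambda>A. d i (y' A)) A" for A
      unfolding z_def \<delta>_def by (rule F.boundary_diff)
    ultimately have "\<delta> z A = 0" for A
      by (simp only: eq d_\<delta>[OF chains_mem[OF y']] diff_self)
    moreover have "z \<in> chains (length js) (Suc m) (free_mod (B i))"
      unfolding z_def
      by (intro F.chains_diff c chains_map[OF y'] hom_on_mem[OF hom] hom_on_0[OF hom])
    ultimately obtain y where "y \<in> chains (length js) (Suc (Suc m)) (free_mod (B i))" "\<delta> y = z"
      using F.boundary_exact[OF js] unfolding \<delta>_def by blast
    then show ?thesis
      using y' by (intro bexI[of _ y] bexI[of _ y']) (auto simp: z_def)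
  qed
qed

text \<open>Coefficients of a boundary are signed sums of values \<open>X j (c A)\<close>, so it
  suffices to test these values.\<close>

lemma (in commuting_endos) boundary_in_subgroup:
  assumes "0 \<in> K" "\<And>u v. u \<in> K \<Longrightarrow> v \<in> K \<Longrightarrow> u + v \<in> K" "\<And>v. v \<in> K \<Longrightarrow> - v \<in> K"
    and "\<And>j A. j \<in> set js \<Longrightarrow> X j (c A) \<in> K"
  shows "boundary X js c A \<in> K"
  using assms(4)
proof (induction js arbitrary: c A)
  case (Cons j js)
  have "boundary X js (\<lambda>B. c (a # B)) A' \<in> K" for a A'
    by (rule Cons.IH) (use Cons.prems in auto)
  then show ?case
    using assms(1-3) Cons.prems by (auto split: list.split)
qed (simp add: assms)

section \<open>Ideals, cosets and the quotient module\<close>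

locale ring_ideal =
  fixes J :: "'r::comm_ring_1 set"
  assumes zero_mem: "0 \<in> J"
    and add_mem: "a \<in> J \<Longrightarrow> b \<in> J \<Longrightarrow> a + b \<in> J"
    and mult_mem: "a \<in> J \<Longrightarrow> r * a \<in> J"
begin

lemma uminus_mem: "a \<in> J \<Longrightarrow> - a \<in> J"
  using mult_mem[of a "- 1"] by simp

lemma diff_mem: "a \<in> J \<Longrightarrow> b \<in> J \<Longrightarrow> a - b \<in> J"
  using add_mem uminus_mem by (metis diff_conv_add_uminus)

lemma coset_subset: "a - b \<in> J \<Longrightarrow> a +o J \<subseteq> b +o J"
proof
  fix x assume ab: "a - b \<in> J" and "x \<in> a +o J"
  then obtain j where j: "j \<in> J" "x = a + j"
    by (auto simp: elt_set_plus_def)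
  then have "x = b + ((a - b) + j)"
    by simp
  then show "x \<in> b +o J"
    using ab j add_mem unfolding elt_set_plus_def by blast
qed

lemma coset_eq_iff: "a +o J = b +o J \<longleftrightarrow> a - b \<in> J"
proof
  assume "a +o J = b +o J"
  moreover have "a + 0 \<in> a +o J"
    using zero_mem unfolding elt_set_plus_def by blast
  ultimately show "a - b \<in> J"
    by (auto simp: elt_set_plus_def)
next
  assume "a - b \<in> J"
  then show "a +o J = b +o J"
    using coset_subset[of a b] coset_subset[of b a] uminus_mem[of "a - b"] by simp
qed

lemma coset_eq_zero_iff: "a +o J = J \<longleftrightarrow> a \<in> J"
  using coset_eq_iff[of a 0] by simp

lemma J_plus_J: "J + J = J"
proof
  show "J + J \<subseteq> J"
    using add_mem by (auto elim!: set_plus_elim)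
  show "J \<subseteq> J + J"
    using set_plus_intro[OF zero_mem] by fastforce
qed

lemma coset_add: "(a +o J) + (b +o J) = (a + b) +o J"
  by (simp add: set_plus_rearrange J_plus_J)

lemma quot_scale_coset: "quot_scale J r (a +o J) = (r * a) +o J"
proof -
  have "r * (a + j) + j' \<in> (r * a) +o J" if "j \<in> J" "j' \<in> J" for j j'
  proof -
    have "r * (a + j) + j' = r * a + (r * j + j')"
      by (simp add: algebra_simps)
    then show ?thesis
      using that add_mem mult_mem unfolding elt_set_plus_def by blast
  qed
  then have "(r *o (a +o J)) + J \<subseteq> (r * a) +o J"
    by (auto simp: elt_set_times_def set_plus_def elt_set_plus_def)
  moreover have "r * a + j \<in> (r *o (a +o J)) + J" if "j \<in> J" for j
  proof -
    have "r * (a + 0) \<in> r *o (a +o J)"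
      using zero_mem unfolding elt_set_times_def elt_set_plus_def by blast
    then show ?thesis
      using that set_plus_intro by fastforce
  qed
  then have "(r * a) +o J \<subseteq> (r *o (a +o J)) + J"
    unfolding elt_set_plus_def by blast
  ultimately show ?thesis
    unfolding quot_scale_def by blast
qed

end

lemma count_list_replicate_True: "count_list (replicate n True) True = n"
  by (induction n) auto

text \<open>A preimage \<open>z\<close> of the class of \<open>w\<close>, placed at the full set, is
  a chain of top degree whose boundary comes from \<open>d 0\<close>. If the resolution were too
  short, the chase would make it a boundary plus an image under \<open>d 0\<close>. There is nothing
  above top degree, so \<open>z\<close> would lie in the image of \<open>d 0\<close> and
  \<open>w\<close> in \<open>J\<close>.\<close>

theorem free_resolution_length_ge:
  fixes J :: "('n::finite, 'k::field) mpoly set"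
  assumes "ring_ideal J" and res: "free_resolution J l B d \<epsilon>"
    and w: "w \<notin> J" "\<And>j. var j * w \<in> J"
  shows "CARD('n) \<le> l"
proof (rule ccontr)
  assume l: "\<not> CARD('n) \<le> l"
  interpret ring_ideal J by fact
  let ?X = "\<lambda>j :: 'n. scale (var j :: ('n, 'k) mpoly)"
  obtain js :: "'n list" where js: "set js = UNIV" "distinct js"
    using finite_distinct_list[of "UNIV :: 'n set"] by auto
  then have n: "length js = CARD('n)"
    by (metis distinct_card)
  then have "length js \<noteq> 0"
    using l by linarith
  then obtain m where m: "length js = Suc m"
    using not0_implies_Suc by blast
  have hom0: "hom_on (B 0) (quot J) (+) (quot_scale J) \<epsilon>"
    and hom: "hom_on (B (Suc i)) (free_mod (B i)) (+) scale (d i)"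
    and surj: "\<epsilon> ` free_mod (B 0) = quot J"
    and ker: "{v \<in> free_mod (B 0). \<epsilon> v = J} = d 0 ` free_mod (B 1)" for i
    using res unfolding free_resolution_def One_nat_def by blast+
  obtain L where "split_endos (free_mod (B 0)) ?X L"
    using split_endos_var by blast
  then interpret F: split_endos "free_mod (B 0)" ?X L .
  have "w +o J \<in> \<epsilon> ` free_mod (B 0)"
    unfolding surj by (simp add: quot_def)
  then obtain z where z: "z \<in> free_mod (B 0)" "\<epsilon> z = w +o J"
    by auto
  define F where "F = replicate (length js) True"
  define c where "c = (\<lambda>A. if A = F then z else 0)"
  have c: "c \<in> chains (length js) (Suc m) (free_mod (B 0))"
    using z m by (auto simp: c_def chains_def F.zero_mem F_def count_list_replicate_True)
  \<comment> \<open>Up to sign only multiples of \<open>z\<close> by variables occur, and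
    \<open>\<epsilon>\<close> maps them to the classes of \<open>var j * w\<close>, which are
    zero.\<close>
  have "boundary ?X js c A \<in> d 0 ` free_mod (B 1)" for A
  proof (rule F.boundary_in_subgroup)
    have hom_d: "d 0 (u + v) = d 0 u + d 0 v" "d 0 (scale r v) = scale r (d 0 v)"
      if "u \<in> free_mod (B 1)" "v \<in> free_mod (B 1)" for u v r
      using hom_on_add[OF hom[of 0]] hom_on_scale[OF hom[of 0]] that by simp_all
    show 0: "0 \<in> d 0 ` free_mod (B 1)"
      using hom_on_0[OF hom[of 0]] by (intro image_eqI[of _ _ 0]) (simp_all add: free_mod_iff)
    show "u + v \<in> d 0 ` free_mod (B 1)" if uv: "u \<in> d 0 ` free_mod (B 1)" "v \<in> d 0 ` free_mod (B 1)" for u v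
    proof -
      obtain u' v' where "u' \<in> free_mod (B 1)" "u = d 0 u'" "v' \<in> free_mod (B 1)" "v = d 0 v'"
        using uv by blast
      then have "u + v = d 0 (u' + v')" "u' + v' \<in> free_mod (B 1)"
        using hom_d(1)[of u' v'] by (simp_all add: free_mod_iff lookup_add)
      then show ?thesis by blast
    qed
    have neg: "scale (- 1) v = - v" for v :: "'b \<Rightarrow>\<^sub>0 ('n, 'k) mpoly"
      by (rule poly_mapping_eqI) simp
    show "- v \<in> d 0 ` free_mod (B 1)" if v: "v \<in> d 0 ` free_mod (B 1)" for v
    proof -
      obtain u where "u \<in> free_mod (B 1)" "v = d 0 u"
        using v by blast
      then have "- v = d 0 (- u)" "- u \<in> free_mod (B 1)"
        using hom_d(2)[of u u "- 1"] by (simp_all add: neg free_mod_iff)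
      then show ?thesis by blast
    qed
    show "?X j (c A) \<in> d 0 ` free_mod (B 1)" for j A
    proof (cases "A = F")
      case True
      have "\<epsilon> (?X j z) = J"
        using hom_on_scale[OF hom0 z(1)] z(2) w(2)
        by (simp add: quot_scale_coset coset_eq_zero_iff)
      then show ?thesis
        unfolding ker[symmetric] using z True by (simp add: c_def F.X_mem)
    qed (use 0 in \<open>simp add: c_def\<close>)
  qed
  then obtain g where g: "\<And>A. g A \<in> free_mod (B 1)" "\<And>A. boundary ?X js c A = d 0 (g A)"
    unfolding image_iff by metis
  define c' where "c' = (\<lambda>A. if boundary ?X js c A = 0 then 0 else g A)"
  have "boundary ?X js c \<in> chains (length js) m (free_mod (B 0))"
    by (rule F.boundary_chains[OF c])
  then have c': "c' \<in> chains (length js) m (free_mod (B (Suc 0)))"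
    using g(1) by (auto simp: chains_def c'_def free_mod_iff)
  have "boundary ?X js c A = d 0 (c' A)" for A
    using g(2) hom_on_0[OF hom[of 0]] by (simp add: c'_def)
  then obtain y e where y: "y \<in> chains (length js) (Suc (Suc m)) (free_mod (B 0))"
    and e: "e \<in> chains (length js) (Suc m) (free_mod (B (Suc 0)))"
    and c_eq: "\<And>A. c A = boundary ?X js y A + d 0 (e A)"
    using resolution_chase[OF res js(2) c c'] l m n by auto
  have "y = (\<lambda>_. 0)"
    using chains_too_big[OF y] m by auto
  then have "z = d 0 (e F)"
    using c_eq[of F] by (simp add: c_def)
  then have "z \<in> {v \<in> free_mod (B 0). \<epsilon> v = J}"
    unfolding ker using chains_mem[OF e] by simp
  then show False
    using z w(1) by (simp add: coset_eq_zero_iff)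
qed

section \<open>A resolution of length \<open>n\<close>\<close>

definition std_monoms :: "'n monom set \<Rightarrow> 'n monom set" where
  "std_monoms G = {m. \<forall>g\<in>G. \<forall>h. m \<noteq> g + h}"

lemma std_monoms_add: "m + a \<in> std_monoms G \<Longrightarrow> m \<in> std_monoms G"
  by (force simp: std_monoms_def add.assoc)

lemma std_monoms_minus:
  "m \<in> std_monoms G \<Longrightarrow> Poly_Mapping.lookup m j \<noteq> 0 \<Longrightarrow> m - Poly_Mapping.single j 1 \<in> std_monoms G"
  by (metis monom_minus_add std_monoms_add)

lemma module_mult: "module ((*) :: 'a::comm_ring_1 \<Rightarrow> 'a \<Rightarrow> 'a)"
  by standard (simp_all add: algebra_simps)

lemma single_mult_single: "Poly_Mapping.single m (c :: 'k::field) * Poly_Mapping.single g 1 = Poly_Mapping.single (m + g) c"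
  by (simp add: mult_single)

text \<open>Polynomials without standard terms form an ideal, as divisors of standard monomials are
  standard; conversely each nonstandard term is a multiple of a generator.\<close>

lemma in_monomial_ideal_iff:
  fixes f :: "('n::finite, 'k::field) mpoly"
  shows "f \<in> monomial_ideal G \<longleftrightarrow> (\<forall>m\<in>std_monoms G. Poly_Mapping.lookup f m = 0)"
proof
  interpret module "(*) :: ('n, 'k) mpoly \<Rightarrow> _" by (rule module_mult)
  let ?T = "{f :: ('n, 'k) mpoly. \<forall>m\<in>std_monoms G. Poly_Mapping.lookup f m = 0}"
  have "span ((\<lambda>m. Poly_Mapping.single m 1) ` G) \<subseteq> ?T"
  proof (rule span_minimal)
    show "(\<lambda>m. Poly_Mapping.single m 1) ` G \<subseteq> ?T"
      by (auto simp: std_monoms_def lookup_single when_def) (metis add.right_neutral)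
    show "subspace ?T"
    proof (rule subspaceI)
      fix r f :: "('n, 'k) mpoly"
      assume f: "f \<in> ?T"
      show "r * f \<in> ?T"
      proof (rule ccontr)
        assume "r * f \<notin> ?T"
        then obtain m where m: "m \<in> std_monoms G" "m \<in> Poly_Mapping.keys (r * f)"
          by (auto simp: in_keys_iff)
        then obtain a b where "m = a + b" "b \<in> Poly_Mapping.keys f"
          using keys_mult[of r f] by blast
        then show False
          using f m(1) std_monoms_add[of b a] by (auto simp: add.commute in_keys_iff)
      qed
    qed (auto simp: lookup_add)
  qed
  then show "f \<in> monomial_ideal G \<Longrightarrow> \<forall>m\<in>std_monoms G. Poly_Mapping.lookup f m = 0"
    by (auto simp: monomial_ideal_def)
  show "f \<in> monomial_ideal G" if f: "\<forall>m\<in>std_monoms G. Poly_Mapping.lookup f m = 0"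
  proof -
    have "Poly_Mapping.single m c \<in> monomial_ideal G" if m: "m \<notin> std_monoms G" for m and c :: 'k
    proof -
      obtain g h where "g \<in> G" "m = h + g"
        using m by (auto simp: std_monoms_def) (metis add.commute)
      then show ?thesis
        unfolding monomial_ideal_def
        using span_scale[OF span_base, of "Poly_Mapping.single g 1" _ "Poly_Mapping.single h c"]
        by (metis image_eqI single_mult_single)
    qed
    moreover have "f = (\<Sum>m\<in>Poly_Mapping.keys f. Poly_Mapping.single m (Poly_Mapping.lookup f m))"
      by (rule poly_mapping_eqI) (simp add: lookup_sum lookup_single when_def in_keys_iff)
    moreover have "m \<notin> std_monoms G" if "m \<in> Poly_Mapping.keys f" for m
      using f that by (auto simp: in_keys_iff)
    ultimately show ?thesis
      unfolding monomial_ideal_def by (metis (no_types, lifting) span_sum)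
  qed
qed

lemma ring_ideal_monomial_ideal: "ring_ideal (monomial_ideal G :: ('n::finite, 'k::field) mpoly set)"
proof -
  interpret module "(*) :: ('n, 'k) mpoly \<Rightarrow> _" by (rule module_mult)
  show ?thesis
    by standard (auto simp: monomial_ideal_def span_zero span_add span_scale)
qed

text \<open>The operators that act on the basis in the resolution. An element of the free module on
  the monomials is read as a polynomial with coefficients in \<open>'r\<close>, so the ring product
  moves the basis, and \<open>mapp\<close> cuts down to \<open>S\<close>.\<close>

definition shift :: "'n::finite monom set \<Rightarrow> 'n \<Rightarrow> ('n monom \<Rightarrow>\<^sub>0 'r::comm_ring_1) \<Rightarrow> ('n monom \<Rightarrow>\<^sub>0 'r)" where
  "shift S j v =
     Poly_Mapping.mapp (\<lambda>m f. f when m \<in> S) (Poly_Mapping.single (Poly_Mapping.single j 1) 1 * v)"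

lemma lookup_shift:
  "Poly_Mapping.lookup (shift S j v) m =
     (if m \<in> S \<and> Poly_Mapping.lookup m j \<noteq> 0 then Poly_Mapping.lookup v (m - Poly_Mapping.single j 1) else 0)"
  by (auto simp: shift_def lookup_mapp lookup_single_mult in_keys_iff when_def simp del: One_nat_def)

lemma shift_single:
  "shift S j (Poly_Mapping.single m f) =
     (if m + Poly_Mapping.single j 1 \<in> S then Poly_Mapping.single (m + Poly_Mapping.single j 1) f else 0)"
proof (rule poly_mapping_eqI)
  fix a
  show "Poly_Mapping.lookup (shift S j (Poly_Mapping.single m f)) a = Poly_Mapping.lookup
      (if m + Poly_Mapping.single j 1 \<in> S then Poly_Mapping.single (m + Poly_Mapping.single j 1) f else 0) a"
    using monom_eq_add_single[of a m j] by (auto simp: lookup_shift lookup_single when_def)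
qed

lemma shift_add: "shift S j (u + v) = shift S j u + shift S j v"
  by (rule poly_mapping_eqI) (simp add: lookup_shift lookup_add)

text \<open>Cutting off after the first variable loses nothing that the second would keep, since
  every divisor of a standard monomial is standard.\<close>

lemma shift_shift:
  fixes v :: "'n::finite monom \<Rightarrow>\<^sub>0 'r::comm_ring_1"
  shows "shift (std_monoms G) i (shift (std_monoms G) j v) = shift (std_monoms G) j (shift (std_monoms G) i v)"
proof (cases "i = j")
  case False
  have "m - Poly_Mapping.single i 1 - Poly_Mapping.single j 1 = m - Poly_Mapping.single j 1 - Poly_Mapping.single i 1"
    for m :: "'n monom"
    by (rule poly_mapping_eqI) (simp add: lookup_minus)
  then show ?thesis
    using False std_monoms_minus[of _ G]
    by (intro poly_mapping_eqI) (auto simp: lookup_shift lookup_minus lookup_single)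
qed simp

lemma shifted_endos_shift:
  "shifted_endos (free_mod (std_monoms G)) (\<lambda>j :: 'n::finite. scale (var j :: ('n, 'k::field) mpoly))
     (\<lambda>j. Poly_Mapping.map (var_div j)) (shift (std_monoms G))"
proof (rule shifted_endos_free_mod)
  fix i j and v :: "'n monom \<Rightarrow>\<^sub>0 ('n, 'k) mpoly"
  show "v \<in> free_mod (std_monoms G) \<Longrightarrow> shift (std_monoms G) j v \<in> free_mod (std_monoms G)"
    by (auto simp: free_mod_iff lookup_shift)
  show "shift (std_monoms G) i (scale (var j) v) = scale (var j) (shift (std_monoms G) i v)"
    by (rule poly_mapping_eqI) (simp add: lookup_shift)
  show "shift (std_monoms G) i (Poly_Mapping.map (var_div j) v) = Poly_Mapping.map (var_div j) (shift (std_monoms G) i v)"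
    by (rule poly_mapping_eqI) (simp add: lookup_shift lookup_map)
qed (rule shift_add shift_shift)+

text \<open>The linear map to the polynomial ring that sends the basis element \<open>m\<close> to
  the monomial \<open>m\<close>; modulo the ideal it becomes the augmentation.\<close>

definition eval_basis :: "('n monom \<Rightarrow>\<^sub>0 ('n::finite, 'k::field) mpoly) \<Rightarrow> ('n, 'k) mpoly" where
  "eval_basis v = (\<Sum>m\<in>Poly_Mapping.keys v. Poly_Mapping.lookup v m * Poly_Mapping.single m 1)"

lemma eval_basis_0 [simp]: "eval_basis 0 = 0"
  by (simp add: eval_basis_def)

lemma eval_basis_single [simp]: "eval_basis (Poly_Mapping.single m f) = f * Poly_Mapping.single m 1"
  by (simp add: eval_basis_def)

lemma eval_basis_add: "eval_basis (u + v) = eval_basis u + eval_basis v"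
  unfolding eval_basis_def by (rule setsum_keys_plus_distrib) (simp_all add: distrib_right)

lemma scale_single: "scale r (Poly_Mapping.single b f) = Poly_Mapping.single b (r * f)"
  by (rule poly_mapping_eqI) (simp add: lookup_single when_def)

lemma eval_basis_scale: "eval_basis (scale r v) = r * eval_basis v"
proof (induction v rule: poly_mapping_add_induct)
  case zero
  have "scale r (0 :: 'a monom \<Rightarrow>\<^sub>0 ('a, 'b) mpoly) = 0"
    by (rule poly_mapping_eqI) simp
  then show ?case by simp
qed (simp_all add: scale_single scale_add eval_basis_add distrib_left mult.assoc)

lemma eval_basis_uminus: "eval_basis (- v) = - eval_basis v"
  using eval_basis_add[of v "- v"] by (simp add: add_eq_0_iff)

lemma eval_basis_diff: "eval_basis (u - v) = eval_basis u - eval_basis v"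
  using eval_basis_add[of u "- v"] by (simp add: eval_basis_uminus)

text \<open>On a basis element either the two terms cancel, or the shift is zero and the product
  with the variable is already in the ideal. Evaluation modulo the ideal therefore kills the images
  of the Koszul operators.\<close>

lemma eval_basis_shift:
  "eval_basis (scale (var j) v - shift (std_monoms G) j v) \<in> monomial_ideal G"
proof -
  interpret ring_ideal "monomial_ideal G :: ('a, 'b) mpoly set"
    by (rule ring_ideal_monomial_ideal)
  show ?thesis
  proof (induction v rule: poly_mapping_add_induct)
    case zero
    have "scale (var j) 0 - shift (std_monoms G) j (0 :: 'a monom \<Rightarrow>\<^sub>0 ('a, 'b) mpoly) = 0"
      by (rule poly_mapping_eqI) (simp add: lookup_minus lookup_shift)
    then show ?case
      by (simp add: zero_mem)
  next
    case (single m f)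
    have "var j * f * Poly_Mapping.single m 1 = f * Poly_Mapping.single (m + Poly_Mapping.single j 1) 1"
      by (simp add: var_def ac_simps mult_single)
    moreover have "f * Poly_Mapping.single (m + Poly_Mapping.single j 1) 1 \<in> monomial_ideal G"
      if "m + Poly_Mapping.single j 1 \<notin> std_monoms G"
    proof (rule mult_mem)
      show "Poly_Mapping.single (m + Poly_Mapping.single j 1) 1 \<in> (monomial_ideal G :: ('a, 'b) mpoly set)"
        using that by (auto simp: in_monomial_ideal_iff lookup_single when_def)
    qed
    ultimately show ?case
      by (auto simp: scale_single shift_single eval_basis_diff zero_mem)
  next
    case (add u v)
    then show ?case
      using add_mem[OF add] by (simp add: scale_add shift_add eval_basis_diff eval_basis_add algebra_simps)
  qed
qed

lemma eval_basis_surj: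
  fixes f :: "('n::finite, 'k::field) mpoly"
  shows "\<exists>v\<in>free_mod (std_monoms G). eval_basis v - f \<in> monomial_ideal G"
proof -
  interpret ring_ideal "monomial_ideal G :: ('n, 'k) mpoly set"
    by (rule ring_ideal_monomial_ideal)
  show ?thesis
  proof (induction f rule: poly_mapping_add_induct)
    case zero
    show ?case
      by (intro bexI[of _ 0]) (auto simp: free_mod_iff zero_mem)
  next
    case (single m c)
    show ?case
    proof (cases "m \<in> std_monoms G")
      case True
      then show ?thesis
        by (intro bexI[of _ "Poly_Mapping.single m (Poly_Mapping.single 0 c)"])
          (auto simp: free_mod_iff lookup_single when_def zero_mem mult_single)
    next
      case False
      then show ?thesis
        by (intro bexI[of _ 0])
          (auto simp: free_mod_iff in_monomial_ideal_iff lookup_single when_def)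
    qed
  next
    case (add f g)
    then obtain u v where uv: "u \<in> free_mod (std_monoms G)" "eval_basis u - f \<in> monomial_ideal G"
      "v \<in> free_mod (std_monoms G)" "eval_basis v - g \<in> monomial_ideal G"
      by blast
    then show ?case
      using add_mem[OF uv(2,4)]
      by (intro bexI[of _ "u + v"]) (auto simp: free_mod_iff eval_basis_add lookup_add algebra_simps)
  qed
qed

text \<open>If all divisions by variables vanish, the coefficients of \<open>v\<close> are
  constants. Its value is then a combination over the field of distinct standard monomials, and
  these are independent modulo the ideal.\<close>

lemma eval_basis_const_eq_0:
  fixes v :: "'n monom \<Rightarrow>\<^sub>0 ('n::finite, 'k::field) mpoly"
  assumes v: "v \<in> free_mod (std_monoms G)" "\<And>j. Poly_Mapping.map (var_div j) v = 0"
    and ev: "eval_basis v \<in> monomial_ideal G"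
  shows "v = 0"
proof -
  have nonconst: "Poly_Mapping.lookup (Poly_Mapping.lookup v m) u = 0" if u: "u \<noteq> 0" for m u
  proof -
    obtain j where j: "Poly_Mapping.lookup u j \<noteq> 0"
      using u by (metis poly_mapping_eqI lookup_zero)
    have "var_div j (Poly_Mapping.lookup v m) = 0"
      using v(2)[of j] lookup_map[of "var_div j" v m] by simp
    then have "Poly_Mapping.lookup (Poly_Mapping.lookup v m) (u - Poly_Mapping.single j 1 + Poly_Mapping.single j 1) = 0"
      by (metis lookup_var_div lookup_zero)
    then show ?thesis
      using monom_minus_add[OF j] by simp
  qed
  define c where "c m = Poly_Mapping.lookup (Poly_Mapping.lookup v m) 0" for m
  have const: "Poly_Mapping.lookup v m = Poly_Mapping.single 0 (c m)" for m
    by (rule poly_mapping_eqI) (auto simp: c_def lookup_single when_def nonconst)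
  have "Poly_Mapping.lookup (eval_basis v) m = c m" for m
  proof -
    have "eval_basis v = (\<Sum>m\<in>Poly_Mapping.keys v. Poly_Mapping.single m (c m))"
      by (simp add: eval_basis_def const mult_single)
    then show ?thesis
      by (simp add: lookup_sum lookup_single when_def in_keys_iff) (metis const lookup_single_eq lookup_zero)
  qed
  then have "c m = 0" if "m \<in> std_monoms G" for m
    using ev that by (simp add: in_monomial_ideal_iff)
  then have "Poly_Mapping.lookup v m = 0" for m
    using v(1) const[of m] by (cases "m \<in> std_monoms G") (auto simp: free_mod_iff)
  then show ?thesis
    by (intro poly_mapping_eqI) simp
qed

lemma scale_diff: "scale r (u - v) = scale r u - scale r v"
  by (rule poly_mapping_eqI) (simp add: lookup_minus right_diff_distrib)

lemma shift_scale: "shift S j (scale r v) = scale r (shift S j v)"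
  by (rule poly_mapping_eqI) (simp add: lookup_shift)

text \<open>Serves to transport the Koszul complex, whose basis is countable, to the prescribed
  index type. Exponent vectors are countable because the variables are finite in number.\<close>

lemma ex_inj_monom:
  "\<exists>\<phi> :: bool list \<times> 'n::finite monom \<Rightarrow> 'i::infinite. inj \<phi>"
proof -
  obtain f :: "nat \<Rightarrow> 'i" where f: "inj f"
    using infinite_countable_subset[OF infinite_UNIV] by auto
  have "inj (\<lambda>(A, m). to_nat (A, Poly_Mapping.lookup m) :: nat)" (is "inj ?g")
    by (rule injI) (auto simp: lookup_inject)
  then have "inj (f \<circ> ?g)"
    using f by (intro inj_compose)
  then show ?thesis
    by blast
qed

lemma finite_chains_basis: "finite {A :: bool list. length A = n}"
  using finite_lists_length_eq[of "UNIV :: bool set" n] by simp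

text \<open>\<open>dec\<close> identifies the free module on \<open>B i\<close> with the Koszul
  chains of degree \<open>i\<close>, and the differential is the Koszul boundary carried over.
  Exactness in positive degrees is \<open>boundary_exact\<close>; in degree 0 it comes from the
  residue.\<close>

theorem ex_free_resolution_monomial_ideal:
  fixes G :: "'n::finite monom set"
  shows "\<exists>(B :: nat \<Rightarrow> 'i::infinite set) d \<epsilon>.
     free_resolution (monomial_ideal G :: ('n, 'k::field) mpoly set) CARD('n) B d \<epsilon>"
proof -
  define J :: "('n, 'k) mpoly set" where "J = monomial_ideal G"
  define S where "S = std_monoms G"
  define N :: "('n monom \<Rightarrow>\<^sub>0 ('n, 'k) mpoly) set" where "N = free_mod S"
  interpret J: ring_ideal J
    unfolding J_def by (rule ring_ideal_monomial_ideal)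
  interpret K: shifted_endos N "\<lambda>j :: 'n. scale (var j)" "\<lambda>j. Poly_Mapping.map (var_div j)" "shift S"
    unfolding N_def S_def by (rule shifted_endos_shift)
  obtain js :: "'n list" where js: "set js = UNIV" "distinct js"
    using finite_distinct_list[of "UNIV :: 'n set"] by auto
  define n where "n = length js"
  have n: "n = CARD('n)"
    using js by (metis distinct_card n_def)
  obtain \<phi> :: "bool list \<times> 'n monom \<Rightarrow> 'i" where \<phi>: "inj \<phi>"
    using ex_inj_monom by blast
  define F where "F = replicate n False"
  define \<delta> where "\<delta> = boundary K.X js"
  define B where "B i = \<phi> ` {(A, m). length A = n \<and> count_list A True = i \<and> m \<in> S}" for i
  define dec where "dec v A = Poly_Mapping.map_key (\<lambda>m. \<phi> (A, m)) v"
    for v :: "'i \<Rightarrow>\<^sub>0 ('n, 'k) mpoly" and A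

  have lookup_dec: "Poly_Mapping.lookup (dec v A) m = Poly_Mapping.lookup v (\<phi> (A, m))" for v A m
  proof -
    have "inj (\<lambda>m. \<phi> (A, m))"
      using \<phi> by (auto simp: inj_def)
    then show ?thesis
      by (simp add: dec_def map_key.rep_eq)
  qed
  have dec_chains: "dec v \<in> chains n i N" if v: "v \<in> free_mod (B i)" for v i
  proof -
    have 0: "Poly_Mapping.lookup v (\<phi> (A, m)) = 0"
      if "\<not> (length A = n \<and> count_list A True = i \<and> m \<in> S)" for A m
    proof -
      have "\<phi> (A, m) \<notin> B i"
        using that by (auto simp: B_def inj_eq[OF \<phi>])
      then show ?thesis
        using v by (simp add: free_mod_iff)
    qed
    have "dec v A = 0" if na: "\<not> (length A = n \<and> count_list A True = i)" for A
    proof (rule poly_mapping_eqI)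
      show "Poly_Mapping.lookup (dec v A) m = Poly_Mapping.lookup 0 m" for m
        unfolding lookup_dec lookup_zero using na by (intro 0) blast
    qed
    moreover have "dec v A \<in> N" for A
      by (simp add: N_def free_mod_iff lookup_dec 0)
    ultimately show ?thesis
      unfolding chains_def by blast
  qed
  have dec_add: "dec (u + v) A = dec u A + dec v A" for u v A
    by (rule poly_mapping_eqI) (simp add: lookup_dec lookup_add)
  have dec_scale: "dec (scale r v) A = scale r (dec v A)" for r v A
    by (rule poly_mapping_eqI) (simp add: lookup_dec)
  have dec_0: "dec 0 A = 0" for A
    by (rule poly_mapping_eqI) (simp add: lookup_dec)
  have dec_inj: "u = v" if u: "u \<in> free_mod (B i)" and v: "v \<in> free_mod (B i)" and "dec u = dec v" for u v i
  proof (rule poly_mapping_eqI)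
    fix x
    show "Poly_Mapping.lookup u x = Poly_Mapping.lookup v x"
    proof (cases "x \<in> B i")
      case True
      then obtain A m where "x = \<phi> (A, m)"
        by (auto simp: B_def)
      then show ?thesis
        using \<open>dec u = dec v\<close> by (metis lookup_dec)
    qed (use u v in \<open>simp add: free_mod_iff\<close>)
  qed
  have dec_surj: "\<exists>v\<in>free_mod (B i). dec v = c" if c: "c \<in> chains n i N" for c i
  proof -
    define f where "f x = (if x \<in> B i then
        Poly_Mapping.lookup (c (fst (inv \<phi> x))) (snd (inv \<phi> x)) else 0)" for x
    have "{x. f x \<noteq> 0} \<subseteq> \<phi> ` (SIGMA A : {A. length A = n}. Poly_Mapping.keys (c A))"
      by (auto simp: f_def B_def inv_f_f[OF \<phi>] in_keys_iff split: if_splits intro!: imageI)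
    then have "finite {x. f x \<noteq> 0}"
      by (rule finite_subset) (auto intro!: finite_imageI finite_SigmaI finite_chains_basis)
    then have f: "Poly_Mapping.lookup (Abs_poly_mapping f) = f"
      by (rule lookup_Abs_poly_mapping)
    have "dec (Abs_poly_mapping f) A = c A" for A
    proof (rule poly_mapping_eqI)
      fix m
      have "Poly_Mapping.lookup (c A) m = 0" if "\<not> (length A = n \<and> count_list A True = i \<and> m \<in> S)"
      proof (cases "c A = 0")
        case False
        then have "m \<notin> S" "c A \<in> free_mod S"
          using c that unfolding chains_def N_def by blast+
        then show ?thesis
          by (simp add: free_mod_iff)
      qed simp
      moreover have "\<phi> (A, m) \<in> B i \<longleftrightarrow> length A = n \<and> count_list A True = i \<and> m \<in> S"
        by (auto simp: B_def inj_eq[OF \<phi>])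
      ultimately show "Poly_Mapping.lookup (dec (Abs_poly_mapping f) A) m = Poly_Mapping.lookup (c A) m"
        by (auto simp: lookup_dec f f_def inv_f_f[OF \<phi>])
    qed
    moreover have "Abs_poly_mapping f \<in> free_mod (B i)"
      by (simp add: free_mod_iff f f_def)
    ultimately show ?thesis
      by (intro bexI[of _ "Abs_poly_mapping f"]) auto
  qed

  \<comment> \<open>The preimage under \<open>dec\<close> exists and is unique on the modules
    concerned, so the choice leaves \<open>d\<close> linear there.\<close>
  define d where "d i v = (SOME u. u \<in> free_mod (B i) \<and> dec u = \<delta> (dec v))" for i v
  define \<epsilon> where "\<epsilon> v = eval_basis (dec v F) +o J" for v
  have d: "d i v \<in> free_mod (B i)" "dec (d i v) = \<delta> (dec v)" if "v \<in> free_mod (B (Suc i))" for i v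
  proof -
    have "\<delta> (dec v) \<in> chains n i N"
      using K.boundary_chains dec_chains[OF that] by (simp add: \<delta>_def n_def)
    then have "\<exists>u. u \<in> free_mod (B i) \<and> dec u = \<delta> (dec v)"
      using dec_surj by blast
    then show "d i v \<in> free_mod (B i)" "dec (d i v) = \<delta> (dec v)"
      unfolding d_def by (metis (mono_tags, lifting) someI_ex)+
  qed
  have add_mem: "u + v \<in> free_mod C" if "u \<in> free_mod C" "v \<in> free_mod C"
    for u v :: "'i \<Rightarrow>\<^sub>0 ('n, 'k) mpoly" and C
    using that by (simp add: free_mod_iff lookup_add)
  have hom_d: "hom_on (B (Suc i)) (free_mod (B i)) (+) scale (d i)" for i
    unfolding hom_on_def
  proof (intro conjI ballI allI subsetI)
    fix u v :: "'i \<Rightarrow>\<^sub>0 ('n, 'k) mpoly"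
    assume uv: "u \<in> free_mod (B (Suc i))" "v \<in> free_mod (B (Suc i))"
    show "d i (u + v) = d i u + d i v"
    proof (rule dec_inj)
      show "dec (d i (u + v)) = dec (d i u + d i v)"
      proof
        fix A
        have "dec (u + v) = (\<lambda>A. dec u A + dec v A)"
          by (rule ext) (rule dec_add)
        then show "dec (d i (u + v)) A = dec (d i u + d i v) A"
          by (simp add: d uv add_mem dec_add[of "d i u"] \<delta>_def K.boundary_add)
      qed
    qed (auto intro!: add_mem d uv)
  next
    fix r and v :: "'i \<Rightarrow>\<^sub>0 ('n, 'k) mpoly"
    assume v: "v \<in> free_mod (B (Suc i))"
    show "d i (scale r v) = scale r (d i v)"
    proof (rule dec_inj)
      have "boundary K.X js (\<lambda>A. scale r (dec v A)) A = scale r (boundary K.X js (dec v) A)" for A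
      proof (rule K.boundary_endo)
        fix j and w :: "'n monom \<Rightarrow>\<^sub>0 ('n, 'k) mpoly"
        show "scale r (K.X j w) = K.X j (scale r w)"
          unfolding K.X_def by (simp only: scale_diff shift_scale scale_scale[of r "var j"])
      qed (rule scale_add)
      moreover have "dec (scale r v) = (\<lambda>A. scale r (dec v A))"
        by (rule ext) (rule dec_scale)
      ultimately show "dec (d i (scale r v)) = dec (scale r (d i v))"
        by (intro ext) (simp add: d v scale_mem dec_scale \<delta>_def)
    qed (auto intro!: scale_mem d v)
  qed (use d in blast)
  have hom_\<epsilon>: "hom_on (B 0) (quot J) (+) (quot_scale J) \<epsilon>"
    unfolding hom_on_def
  proof (intro conjI ballI allI)
    show "\<epsilon> ` free_mod (B 0) \<subseteq> quot J"
      by (auto simp: \<epsilon>_def quot_def)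
  qed (simp_all only: \<epsilon>_def dec_add dec_scale eval_basis_add eval_basis_scale J.coset_add J.quot_scale_coset)
  have surj: "\<epsilon> ` free_mod (B 0) = quot J"
  proof
    show "\<epsilon> ` free_mod (B 0) \<subseteq> quot J"
      by (auto simp: \<epsilon>_def quot_def)
    show "quot J \<subseteq> \<epsilon> ` free_mod (B 0)"
    proof
      fix x assume "x \<in> quot J"
      then obtain f where x: "x = f +o J"
        by (auto simp: quot_def)
      obtain v0 where v0: "v0 \<in> N" "eval_basis v0 - f \<in> J"
        using eval_basis_surj unfolding N_def S_def J_def by blast
      define c where "c A = (if A = F then v0 else 0)" for A
      have "c \<in> chains n 0 N"
        using v0(1) count_list_True_0[of F] by (auto simp: chains_def c_def K.zero_mem F_def)
      then obtain v where v: "v \<in> free_mod (B 0)" "dec v = c"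
        using dec_surj by blast
      then have "\<epsilon> v = x"
        using v0(2) by (simp add: \<epsilon>_def c_def x J.coset_eq_iff)
      then show "x \<in> \<epsilon> ` free_mod (B 0)"
        using v by blast
    qed
  qed
  have ev_X: "eval_basis (K.X j v) \<in> J" for j v
    unfolding K.X_def unfolding J_def S_def by (rule eval_basis_shift)
  have ker_\<epsilon>: "{v \<in> free_mod (B 0). \<epsilon> v = J} = d 0 ` free_mod (B (Suc 0))"
  proof (intro equalityI subsetI)
    fix v assume "v \<in> {v \<in> free_mod (B 0). \<epsilon> v = J}"
    then have v: "v \<in> free_mod (B 0)" "eval_basis (dec v F) \<in> J"
      by (auto simp: \<epsilon>_def J.coset_eq_zero_iff)
    have vF: "dec v F \<in> N"
      using dec_chains[OF v(1)] by (rule chains_mem)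
    \<comment> \<open>Taking residues changes the value only by an element of the ideal, since each
      step subtracts something in the image of an operator.\<close>
    have res: "eval_basis w - eval_basis (K.residue is w) \<in> J" for "is" w
    proof (induction "is" arbitrary: w)
      case (Cons j "is")
      have "eval_basis w - eval_basis (K.retract j w) \<in> J"
        by (simp add: K.retract_def eval_basis_diff ev_X)
      then show ?case
        using J.add_mem[OF _ Cons.IH[of "K.retract j w"]] by fastforce
    qed (simp add: J.zero_mem)
    have "K.residue js (dec v F) = 0"
    proof (rule eval_basis_const_eq_0)
      show "K.residue js (dec v F) \<in> free_mod (std_monoms G)"
        using K.residue_mem[OF vF] by (simp add: N_def S_def)
      show "Poly_Mapping.map (var_div j) (K.residue js (dec v F)) = 0" for j
        by (rule K.D_residue) (simp_all add: js)
      show "eval_basis (K.residue js (dec v F)) \<in> monomial_ideal G"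
        using J.diff_mem[OF v(2) res[of "dec v F" js]] by (simp add: J_def)
    qed
    then obtain b where b: "b \<in> chains n 1 N" "\<delta> b = (\<lambda>A. if A = F then dec v F else 0)"
      using K.residue_eq_0_imp_boundary[OF js(2) vF] unfolding n_def F_def \<delta>_def by blast
    then obtain u where u: "u \<in> free_mod (B 1)" "dec u = b"
      using dec_surj by blast
    have "dec v A = 0" if "A \<noteq> F" for A
      using dec_chains[OF v(1)] that count_list_True_0[of A] by (auto simp: chains_def F_def)
    then have "\<delta> b = dec v"
      using b(2) by auto
    then have "d 0 u = v"
      using u v(1) d[of u 0] by (intro dec_inj[of _ 0]) simp_all
    then show "v \<in> d 0 ` free_mod (B (Suc 0))"
      using u by auto
  next
    fix v :: "'i \<Rightarrow>\<^sub>0 ('n, 'k) mpoly"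
    assume "v \<in> d 0 ` free_mod (B (Suc 0))"
    then obtain u where u: "u \<in> free_mod (B (Suc 0))" "v = d 0 u"
      by blast
    have "\<delta> (dec u) F \<in> {w. eval_basis w \<in> J}"
      unfolding \<delta>_def
      by (rule K.boundary_in_subgroup)
        (auto simp: eval_basis_add eval_basis_uminus J.zero_mem J.add_mem J.uminus_mem ev_X)
    then show "v \<in> {v \<in> free_mod (B 0). \<epsilon> v = J}"
      using u d[OF u(1)] by (simp add: \<epsilon>_def J.coset_eq_zero_iff)
  qed
  have exact: "{v \<in> free_mod (B (Suc i)). d i v = 0} = d (Suc i) ` free_mod (B (Suc (Suc i)))" for i
  proof (intro equalityI subsetI)
    fix v assume "v \<in> {v \<in> free_mod (B (Suc i)). d i v = 0}"
    then have v: "v \<in> free_mod (B (Suc i))" "d i v = 0"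
      by auto
    have "\<delta> (dec v) A = 0" for A
      using d(2)[OF v(1)] v(2) dec_0 by metis
    then obtain b where "b \<in> chains n (Suc (Suc i)) N" "\<delta> b = dec v"
      using K.boundary_exact[OF js(2) dec_chains[OF v(1), unfolded n_def]]
      unfolding \<delta>_def n_def by blast
    then obtain u where u: "u \<in> free_mod (B (Suc (Suc i)))" "\<delta> (dec u) = dec v"
      using dec_surj by blast
    then have "d (Suc i) u = v"
      using v(1) d[of u "Suc i"] by (intro dec_inj[of _ "Suc i"]) simp_all
    then show "v \<in> d (Suc i) ` free_mod (B (Suc (Suc i)))"
      using u by auto
  next
    fix v :: "'i \<Rightarrow>\<^sub>0 ('n, 'k) mpoly"
    assume "v \<in> d (Suc i) ` free_mod (B (Suc (Suc i)))"
    then obtain u where u: "u \<in> free_mod (B (Suc (Suc i)))" "v = d (Suc i) u"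
      by blast
    note du = d[OF u(1)]
    have "d i v = 0"
    proof (rule dec_inj)
      have "\<delta> (\<delta> (dec u)) A = 0" for A
        by (simp add: \<delta>_def K.boundary_boundary)
      then show "dec (d i v) = dec 0"
        using du d[OF du(1)] by (intro ext) (simp add: u(2) dec_0)
    qed (use d[OF du(1)] in \<open>simp_all add: u(2) free_mod_iff\<close>)
    then show "v \<in> {v \<in> free_mod (B (Suc i)). d i v = 0}"
      using du u(2) by simp
  qed
  have B_empty: "B i = {}" if "n < i" for i
  proof -
    have "\<not> (length A = n \<and> count_list A True = i)" for A
      using count_le_length[of A True] that by auto
    then show ?thesis
      unfolding B_def by blast
  qed
  have "free_resolution J n B d \<epsilon>"
    unfolding free_resolution_def One_nat_def
    by (intro conjI allI impI B_empty hom_\<epsilon> hom_d surj ker_\<epsilon> exact)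
  then show ?thesis
    unfolding J_def n by (intro exI)
qed

section \<open>Random generators\<close>

lemma not_std_monoms_dominating:
  fixes m :: "'n monom"
  assumes "g \<in> G" "\<And>j. Poly_Mapping.lookup g j \<le> Poly_Mapping.lookup m j"
  shows "m \<notin> std_monoms G"
proof -
  have "m = g + (m - g)"
    by (rule poly_mapping_eqI) (simp add: lookup_add lookup_minus assms(2))
  then show ?thesis
    using assms(1) by (auto simp: std_monoms_def)
qed

text \<open>A substitute for the pure power of the \<open>i\<close>-th variable: for monomials with
  all exponents at least \<open>c\<close>, a generator of this kind still bounds the
  \<open>i\<close>-th exponent of the standard ones, and there are many candidates.\<close>

definition near_axis :: "nat \<Rightarrow> nat \<Rightarrow> 'n \<Rightarrow> 'n::finite monom set" where
  "near_axis D c i = {m \<in> monoms_of_degree D. \<forall>j. j \<noteq> i \<longrightarrow> Poly_Mapping.lookup m j \<le> c}"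

text \<open>Among the standard multiples of \<open>b\<close> one of largest degree is taken. Their
  exponents are at most \<open>D\<close>: beyond that in direction \<open>i\<close>, a generator in
  \<open>near_axis D c i\<close> would divide. A standard product with a variable would again be
  such a multiple, of larger degree.\<close>

lemma ex_socle_monom:
  fixes G :: "'n::finite monom set"
  assumes G: "G \<subseteq> monoms_of_degree D" and c: "CARD('n) * c < D"
    and near: "\<And>i. G \<inter> near_axis D c i \<noteq> {}"
  shows "\<exists>m\<in>std_monoms G. \<forall>j. m + Poly_Mapping.single j 1 \<notin> std_monoms G"
proof -
  define T where "T = {m \<in> std_monoms G. \<forall>j. c \<le> Poly_Mapping.lookup m j}"
  define deg where "deg m = (\<Sum>j\<in>UNIV. Poly_Mapping.lookup m j)" for m :: "'n monom"
  define b :: "'n monom" where "b = Abs_poly_mapping (\<lambda>_. c)"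
  have b: "Poly_Mapping.lookup b j = c" for j
    unfolding b_def by (subst lookup_Abs_poly_mapping) auto
  have "b \<noteq> g + h" if "g \<in> G" for g h
  proof
    assume "b = g + h"
    then have "deg b = deg g + deg h"
      by (simp add: deg_def lookup_add sum.distrib)
    moreover have "deg g = D"
      using G that by (auto simp: deg_def monoms_of_degree_def)
    moreover have "deg b = CARD('n) * c"
      by (simp add: deg_def b)
    ultimately show False
      using c by simp
  qed
  then have bT: "b \<in> T"
    by (simp add: T_def std_monoms_def b)
  have deg_le: "deg m \<le> CARD('n) * D" if m: "m \<in> T" for m
  proof -
    have "Poly_Mapping.lookup m i \<le> D" for i
    proof (rule ccontr)
      assume i: "\<not> Poly_Mapping.lookup m i \<le> D"
      obtain g where g: "g \<in> G" "g \<in> near_axis D c i"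
        using near by blast
      then have "Poly_Mapping.lookup g i \<le> D"
        using member_le_sum[of i UNIV "Poly_Mapping.lookup g"]
        by (auto simp: near_axis_def monoms_of_degree_def)
      then have "Poly_Mapping.lookup g j \<le> Poly_Mapping.lookup m j" for j
        using g(2) m i by (cases "j = i") (auto simp: near_axis_def T_def intro: order_trans)
      then show False
        using not_std_monoms_dominating[OF g(1)] m by (auto simp: T_def)
    qed
    then show ?thesis
      unfolding deg_def using sum_bounded_above[of UNIV "Poly_Mapping.lookup m" D] by simp
  qed
  obtain m where m: "m \<in> T" "\<And>m'. m' \<in> T \<Longrightarrow> deg m' \<le> deg m"
    using ex_has_greatest_nat[of "\<lambda>m. m \<in> T" b deg "Suc (CARD('n) * D)"] bT deg_le
    by (auto simp: less_Suc_eq_le)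
  have "m + Poly_Mapping.single j 1 \<notin> std_monoms G" for j
  proof
    assume "m + Poly_Mapping.single j 1 \<in> std_monoms G"
    then have "m + Poly_Mapping.single j 1 \<in> T"
      using m(1) by (auto simp: T_def lookup_add intro: trans_le_add1)
    moreover have "deg (m + Poly_Mapping.single j 1) = deg m + 1"
      by (simp add: deg_def lookup_add sum.distrib lookup_single when_def)
    ultimately show False
      using m(2) by fastforce
  qed
  then show ?thesis
    using m(1) by (auto simp: T_def)
qed

section \<open>Projective dimension for generators near all axes and for no generators\<close>

lemma pdim_quot_eqI:
  fixes J :: "'r::comm_ring_1 set"
  assumes "\<exists>(B :: nat \<Rightarrow> 'i::infinite set) d \<epsilon>. free_resolution J l B d \<epsilon>"
    and "\<And>l' (B :: nat \<Rightarrow> 'i set) d \<epsilon>. free_resolution J l' B d \<epsilon> \<Longrightarrow> l \<le> l'"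
  shows "pdim_quot TYPE('i) J = enat l"
  unfolding pdim_quot_def
proof (rule antisym)
  show "Inf {enat l |l. \<exists>(B :: nat \<Rightarrow> 'i set) d \<epsilon>. free_resolution J l B d \<epsilon>} \<le> enat l"
    using assms(1) by (intro Inf_lower) blast
  show "enat l \<le> Inf {enat l |l. \<exists>(B :: nat \<Rightarrow> 'i set) d \<epsilon>. free_resolution J l B d \<epsilon>}"
    using assms(2) by (intro Inf_greatest) auto
qed

lemma pdim_quot_monomial_ideal_eq_card:
  fixes G :: "'n::finite monom set"
  assumes G: "G \<subseteq> monoms_of_degree D" and c: "CARD('n) * c < D"
    and near: "\<And>i. G \<inter> near_axis D c i \<noteq> {}"
  shows "pdim_quot TYPE('i::infinite) (monomial_ideal G :: ('n, 'k::field) mpoly set) = enat CARD('n)"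
proof (rule pdim_quot_eqI[OF ex_free_resolution_monomial_ideal])
  obtain m where m: "m \<in> std_monoms G" "\<And>j. m + Poly_Mapping.single j 1 \<notin> std_monoms G"
    using ex_socle_monom[OF assms] by blast
  let ?w = "Poly_Mapping.single m 1 :: ('n, 'k) mpoly"
  have w: "?w \<notin> monomial_ideal G"
    using m(1) by (auto simp: in_monomial_ideal_iff lookup_single intro!: bexI[of _ m])
  have "var j * ?w = Poly_Mapping.single (m + Poly_Mapping.single j 1) 1" for j
    by (simp add: var_def mult_single add.commute)
  then have "var j * ?w \<in> monomial_ideal G" for j
    using m(2) by (auto simp: in_monomial_ideal_iff lookup_single when_def)
  then show "CARD('n) \<le> l" if "free_resolution (monomial_ideal G :: ('n, 'k) mpoly set) l B d \<epsilon>"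
    for l and B :: "nat \<Rightarrow> 'i set" and d \<epsilon>
    using free_resolution_length_ge[OF ring_ideal_monomial_ideal that w] by blast
qed

lemma pdim_quot_zero_ideal:
  "pdim_quot TYPE('i::infinite) ({0} :: 'r::comm_ring_1 set) = 0"
proof -
  fix i :: 'i
  interpret ring_ideal "{0} :: 'r set"
    by standard auto
  \<comment> \<open>The ring itself, free of rank one on an arbitrary index.\<close>
  define B where "B k = (if k = 0 then {i} else {})" for k :: nat
  define \<epsilon> where "\<epsilon> v = Poly_Mapping.lookup v i +o {0}" for v :: "'i \<Rightarrow>\<^sub>0 'r"
  have B0: "free_mod (B 0) = range (\<lambda>r :: 'r. Poly_Mapping.single i r)"
  proof (intro equalityI subsetI)
    fix v :: "'i \<Rightarrow>\<^sub>0 'r" assume "v \<in> free_mod (B 0)"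
    then have "v = Poly_Mapping.single i (Poly_Mapping.lookup v i)"
      by (intro poly_mapping_eqI) (auto simp: free_mod_iff B_def lookup_single when_def)
    then show "v \<in> range (\<lambda>r. Poly_Mapping.single i r)" by blast
  qed (auto simp: free_mod_iff B_def lookup_single when_def)
  have BS: "free_mod (B (Suc k)) = {0 :: 'i \<Rightarrow>\<^sub>0 'r}" for k
    by (auto simp: free_mod_def B_def)
  have scale_0: "scale r 0 = (0 :: 'i \<Rightarrow>\<^sub>0 'r)" for r
    by (rule poly_mapping_eqI) simp
  have "free_resolution {0} 0 B (\<lambda>_ _. 0) \<epsilon>"
    unfolding free_resolution_def
  proof (intro conjI allI)
    show "hom_on (B 0) (quot {0}) (+) (quot_scale {0}) \<epsilon>"
      unfolding hom_on_def
      by (intro conjI ballI allI)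
        (auto simp only: \<epsilon>_def quot_def lookup_add lookup_scale coset_add quot_scale_coset)
    show "hom_on (B (Suc k)) (free_mod (B k)) (+) scale (\<lambda>_. 0 :: 'i \<Rightarrow>\<^sub>0 'r)" for k
      unfolding hom_on_def by (auto simp: scale_0 free_mod_iff)
    show "\<epsilon> ` free_mod (B 0) = quot {0}"
      by (simp add: B0 \<epsilon>_def quot_def image_image)
    show "{v \<in> free_mod (B 0). \<epsilon> v = {0}} = (\<lambda>_. 0) ` (free_mod (B 1) :: ('i \<Rightarrow>\<^sub>0 'r) set)"
      unfolding One_nat_def BS B0 by (auto simp: \<epsilon>_def coset_eq_zero_iff simp del: set_zero intro: range_eqI[of _ _ 0])
  qed (auto simp: BS, simp add: B_def)
  then show ?thesis
    using pdim_quot_eqI[of "{0} :: 'r set" 0] by (force simp: zero_enat_def)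
qed

lemma monomial_ideal_empty: "monomial_ideal {} = ({0} :: ('n::finite, 'k::field) mpoly set)"
proof -
  interpret module "(*) :: ('n, 'k) mpoly \<Rightarrow> _" by (rule module_mult)
  show ?thesis
    by (simp add: monomial_ideal_def span_empty)
qed

text \<open>A monomial of given degree is determined by its exponents other than the \<open>i\<close>-th.\<close>

definition forget :: "'n \<Rightarrow> 'n monom \<Rightarrow> 'n \<Rightarrow> nat" where
  "forget i m = restrict (Poly_Mapping.lookup m) (UNIV - {i})"

lemma card_Compl_single: "card (UNIV - {i :: 'n::finite}) = CARD('n) - 1"
  by (simp add: card_Diff_singleton)

lemma card_monoms_of_degree_le:
  "card (monoms_of_degree D :: 'n::finite monom set) \<le> (D + 1) ^ (CARD('n) - 1)"
proof -
  fix i :: 'n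
  have "inj_on (forget i) (monoms_of_degree D)"
  proof (rule inj_onI, rule poly_mapping_eqI)
    fix u v :: "'n monom" and j
    assume u: "u \<in> monoms_of_degree D" and v: "v \<in> monoms_of_degree D" and eq: "forget i u = forget i v"
    have off: "Poly_Mapping.lookup u k = Poly_Mapping.lookup v k" if "k \<noteq> i" for k
      using fun_cong[OF eq, of k] that by (simp add: forget_def)
    then have "(\<Sum>k\<in>UNIV - {i}. Poly_Mapping.lookup u k) = (\<Sum>k\<in>UNIV - {i}. Poly_Mapping.lookup v k)"
      by (intro sum.cong) auto
    moreover have "D = Poly_Mapping.lookup w i + (\<Sum>k\<in>UNIV - {i}. Poly_Mapping.lookup w k)"
      if "w \<in> monoms_of_degree D" for w
      using that sum.remove[of UNIV i "Poly_Mapping.lookup w"] by (simp add: monoms_of_degree_def)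
    ultimately have "Poly_Mapping.lookup u i = Poly_Mapping.lookup v i"
      using u v by (metis add_right_cancel)
    then show "Poly_Mapping.lookup u j = Poly_Mapping.lookup v j"
      using off by metis
  qed
  moreover have "Poly_Mapping.lookup m j \<le> D" if "m \<in> monoms_of_degree D" for m :: "'n monom" and j
    using that member_le_sum[of j UNIV "Poly_Mapping.lookup m"] by (simp add: monoms_of_degree_def)
  then have "forget i ` monoms_of_degree D \<subseteq> (UNIV - {i}) \<rightarrow>\<^sub>E {..D}"
    by (intro image_subsetI) (simp only: forget_def restrict_PiE_iff atMost_iff Ball_def simp_thms)
  ultimately have "card (monoms_of_degree D :: 'n monom set) \<le> card ((UNIV - {i}) \<rightarrow>\<^sub>E {..D})"
    by (intro card_inj_on_le) (auto intro!: finite_PiE)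
  also have "\<dots> = (D + 1) ^ (CARD('n) - 1)"
    by (simp add: card_PiE card_Compl_single)
  finally show ?thesis .
qed

lemma near_axis_subset: "near_axis D c i \<subseteq> monoms_of_degree D"
  by (auto simp: near_axis_def)

lemma card_near_axis_ge:
  fixes i :: "'n::finite"
  assumes "CARD('n) * c < D"
  shows "(c + 1) ^ (CARD('n) - 1) \<le> card (near_axis D c i)"
proof -
  have "((UNIV - {i}) \<rightarrow>\<^sub>E {..c}) \<subseteq> forget i ` near_axis D c i"
  proof
    fix f assume f: "f \<in> (UNIV - {i}) \<rightarrow>\<^sub>E {..c}"
    define s where "s = sum f (UNIV - {i})"
    \<comment> \<open>The \<open>i\<close>-th exponent makes up the degree; the estimate of
      \<open>s\<close> below ensures that the subtraction is not truncated.\<close>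
    define m where "m = Abs_poly_mapping (\<lambda>j. if j = i then D - s else f j)"
    have m: "Poly_Mapping.lookup m j = (if j = i then D - s else f j)" for j
      unfolding m_def by (subst lookup_Abs_poly_mapping) auto
    have "s \<le> (CARD('n) - 1) * c"
      unfolding s_def using sum_bounded_above[of "UNIV - {i}" f c] f
      by (auto simp: card_Compl_single)
    also have "\<dots> \<le> CARD('n) * c"
      by (intro mult_right_mono) auto
    finally have "s \<le> D"
      using assms by simp
    moreover have "(\<Sum>j\<in>UNIV - {i}. Poly_Mapping.lookup m j) = s"
      unfolding s_def by (intro sum.cong) (auto simp: m)
    ultimately have "(\<Sum>j\<in>UNIV. Poly_Mapping.lookup m j) = D"
      using sum.remove[of UNIV i "Poly_Mapping.lookup m"] by (simp add: m)
    then have "m \<in> near_axis D c i"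
      using f by (auto simp: near_axis_def monoms_of_degree_def m)
    moreover have "forget i m = f"
      using f by (auto simp: forget_def m fun_eq_iff PiE_def extensional_def)
    ultimately show "f \<in> forget i ` near_axis D c i"
      by blast
  qed
  moreover have "finite (near_axis D c i)"
    using finite_monoms_of_degree near_axis_subset by (rule finite_subset[rotated])
  ultimately have "card ((UNIV - {i}) \<rightarrow>\<^sub>E {..c}) \<le> card (near_axis D c i)"
    by (intro surj_card_le) auto
  then show ?thesis
    by (simp add: card_PiE card_Compl_single)
qed

section \<open>Probability bounds for the random generators\<close>

lemma prob_random_gens_avoid:
  fixes R :: "'n::finite monom set"
  assumes p: "0 \<le> p" "p \<le> 1" and R: "R \<subseteq> monoms_of_degree D"
  shows "measure_pmf.prob (random_gens D p) {G. G \<inter> R = {}} = (1 - p) ^ card R"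
proof -
  let ?A = "monoms_of_degree D :: 'n monom set"
  have "(\<lambda>f. {m. f m}) -` {G. G \<inter> R = {}} = Pi ?A (\<lambda>m. if m \<in> R then {False} else UNIV)"
    using R by (auto simp: Pi_def split: if_splits)
  then have "measure_pmf.prob (random_gens D p) {G. G \<inter> R = {}}
      = (\<Prod>m\<in>?A. measure_pmf.prob (bernoulli_pmf p) (if m \<in> R then {False} else UNIV))"
    by (simp add: random_gens_def measure_Pi_pmf_Pi finite_monoms_of_degree)
  also have "\<dots> = (\<Prod>m\<in>?A. if m \<in> R then 1 - p else 1)"
    using p by (intro prod.cong) (auto simp: measure_pmf_single)
  also have "\<dots> = (1 - p) ^ card R"
    using R by (subst prod.inter_restrict[symmetric]) (auto simp: finite_monoms_of_degree Int_absorb1)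
  finally show ?thesis .
qed

lemma set_random_gens: "G \<in> set_pmf (random_gens D p) \<Longrightarrow> G \<subseteq> monoms_of_degree D"
  using set_Pi_pmf_subset'[OF finite_monoms_of_degree, of D False "\<lambda>_. bernoulli_pmf p"]
  by (auto simp: random_gens_def PiE_dflt_def)

text \<open>Union bound over the directions. A direction is missed with probability a power of
  \<open>1 - p\<close>, at most the same power of \<open>exp (- p)\<close>, and the exponent may be
  lowered to the lower bound on the count.\<close>

lemma prob_random_gens_near_axis:
  assumes p: "0 \<le> p" "p \<le> 1" and c: "CARD('n::finite) * c < D"
  shows "1 - real CARD('n) * exp (- (p * real (c + 1) ^ (CARD('n) - 1)))
    \<le> measure_pmf.prob (random_gens D p) {G. \<forall>i :: 'n. G \<inter> near_axis D c i \<noteq> {}}"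
proof -
  let ?P = "measure_pmf.prob (random_gens D p)"
  let ?E = "\<lambda>i :: 'n. {G. G \<inter> near_axis D c i = {}}"
  have "?P (?E i) \<le> exp (- (p * real (c + 1) ^ (CARD('n) - 1)))" for i
  proof -
    have "?P (?E i) = (1 - p) ^ card (near_axis D c i)"
      by (rule prob_random_gens_avoid[OF p near_axis_subset])
    also have "\<dots> \<le> (1 - p) ^ ((c + 1) ^ (CARD('n) - 1))"
      using p card_near_axis_ge[OF c] by (intro power_decreasing) auto
    also have "\<dots> \<le> exp (- p) ^ ((c + 1) ^ (CARD('n) - 1))"
      using p exp_ge_add_one_self[of "- p"] by (intro power_mono) auto
    also have "\<dots> = exp (- (p * real (c + 1) ^ (CARD('n) - 1)))"
      by (simp add: mult.commute flip: exp_of_nat_mult)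
    finally show ?thesis .
  qed
  then have sum_le: "(\<Sum>i\<in>UNIV. ?P (?E i)) \<le> real CARD('n) * exp (- (p * real (c + 1) ^ (CARD('n) - 1)))"
    using sum_bounded_above[of UNIV "\<lambda>i. ?P (?E i)"] by simp
  have union_le: "?P (\<Union>i. ?E i) \<le> (\<Sum>i\<in>UNIV. ?P (?E i))"
    by (rule measure_pmf.finite_measure_subadditive_finite) auto
  have "?P {G. \<forall>i :: 'n. G \<inter> near_axis D c i \<noteq> {}} = 1 - ?P (\<Union>i. ?E i)"
  proof -
    have "{G. \<forall>i :: 'n. G \<inter> near_axis D c i \<noteq> {}} = space (random_gens D p) - (\<Union>i. ?E i)"
      by auto
    then show ?thesis
      by (simp only: measure_pmf.prob_compl sets_measure_pmf UNIV_I)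
  qed
  then show ?thesis
    using order_trans[OF union_le sum_le] by (simp only: diff_left_mono)
qed

lemma prob_pdim_eq_0_ge:
  assumes p: "0 \<le> p" "p \<le> 1"
  shows "1 - real (D + 1) ^ (CARD('n) - 1) * p
    \<le> measure_pmf.prob (random_monomial_ideal D p :: ('n::finite, 'k::field) mpoly set pmf)
        {J. pdim_quot TYPE('i::infinite) J = 0}"
proof -
  let ?A = "monoms_of_degree D :: 'n monom set"
  have "real (card ?A) \<le> real (D + 1) ^ (CARD('n) - 1)"
    by (metis card_monoms_of_degree_le of_nat_le_iff of_nat_power)
  then have "1 - real (D + 1) ^ (CARD('n) - 1) * p \<le> 1 - real (card ?A) * p"
    using p by (intro diff_left_mono mult_right_mono)
  also have "\<dots> \<le> (1 - p) ^ card ?A"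
    using Bernoulli_inequality[of "- p" "card ?A"] p by simp
  also have "\<dots> = measure_pmf.prob (random_gens D p) {G. G \<inter> ?A = {}}"
    by (simp add: prob_random_gens_avoid p)
  also have "\<dots> \<le> measure_pmf.prob (random_gens D p)
      {G. pdim_quot TYPE('i) (monomial_ideal G :: ('n, 'k) mpoly set) = 0}"
  \<comment> \<open>Avoiding all monomials of degree \<open>D\<close> means being empty only on the
    support of the distribution, hence monotonicity up to a null set.\<close>
  proof (rule measure_pmf.finite_measure_mono_AE)
    show "AE G in random_gens D p. G \<in> {G. G \<inter> ?A = {}} \<longrightarrow>
        G \<in> {G. pdim_quot TYPE('i) (monomial_ideal G :: ('n, 'k) mpoly set) = 0}"
    proof (rule AE_pmfI, safe)
      fix G :: "'n monom set"
      assume "G \<in> set_pmf (random_gens D p)" "G \<inter> ?A = {}"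
      then have "G = {}"
        using set_random_gens[of G D p] by blast
      then show "pdim_quot TYPE('i) (monomial_ideal G :: ('n, 'k) mpoly set) = 0"
        by (simp only: monomial_ideal_empty pdim_quot_zero_ideal)
    qed
  qed simp
  finally show ?thesis
    by (simp add: random_monomial_ideal_def vimage_def)
qed

lemma prob_pdim_eq_card_ge:
  assumes p: "0 \<le> p" "p \<le> 1" and D: "D \<ge> 1"
  shows "1 - real CARD('n) * exp (- (p * (real D / real CARD('n)) ^ (CARD('n) - 1)))
    \<le> measure_pmf.prob (random_monomial_ideal D p :: ('n::finite, 'k::field) mpoly set pmf)
        {J. pdim_quot TYPE('i::infinite) J = enat CARD('n)}"
proof -
  \<comment> \<open>The largest \<open>c\<close> with \<open>CARD('n) * c < D\<close>; being
    largest, it also gives \<open>D \<le> CARD('n) * (c + 1)\<close>, which bounds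
    \<open>c + 1\<close> from below.\<close>
  define c where "c = (D - 1) div CARD('n)"
  have c: "CARD('n) * c < D"
    using D times_div_less_eq_dividend[of "CARD('n)" "D - 1"] unfolding c_def by linarith
  have "D \<le> CARD('n) * (c + 1)"
    using D dividend_less_times_div[of "CARD('n)" "D - 1"] unfolding c_def by simp
  then have "real D \<le> real CARD('n) * real (c + 1)"
    by (metis of_nat_le_iff of_nat_mult)
  then have "real D / real CARD('n) \<le> real (c + 1)"
    by (simp add: divide_le_eq mult.commute)
  then have "1 - real CARD('n) * exp (- (p * (real D / real CARD('n)) ^ (CARD('n) - 1)))
      \<le> 1 - real CARD('n) * exp (- (p * real (c + 1) ^ (CARD('n) - 1)))"
    using p by (simp add: mult_left_mono power_mono)
  also have "\<dots> \<le> measure_pmf.prob (random_gens D p) {G. \<forall>i :: 'n. G \<inter> near_axis D c i \<noteq> {}}"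
    by (rule prob_random_gens_near_axis[OF p c])
  also have "\<dots> \<le> measure_pmf.prob (random_gens D p)
      {G. pdim_quot TYPE('i) (monomial_ideal G :: ('n, 'k) mpoly set) = enat CARD('n)}"
    by (rule measure_pmf.finite_measure_mono_AE)
      (use pdim_quot_monomial_ideal_eq_card[OF set_random_gens c] in \<open>auto intro!: AE_pmfI\<close>)
  finally show ?thesis
    by (simp add: random_monomial_ideal_def vimage_def)
qed

section \<open>Passage to the limit\<close>

lemma asymp_almost_surelyI:
  assumes "\<forall>\<^sub>F D in sequentially. 1 - f D \<le> measure_pmf.prob (X D) {x. P x}" "f \<longlonglongrightarrow> 0"
  shows "asymp_almost_surely X P"
  unfolding asymp_almost_surely_def
proof (rule tendsto_sandwich[OF assms(1)])
  show "(\<lambda>D. 1 - f D) \<longlonglongrightarrow> 1"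
    using tendsto_diff[OF tendsto_const[of 1] assms(2)] by simp
qed auto

lemma powi_one_minus_card:
  "D \<ge> 1 \<Longrightarrow> real D powi (1 - int CARD('n::finite)) = 1 / real D ^ (CARD('n) - 1)"
proof -
  have "1 - int CARD('n) = - int (CARD('n) - 1)"
    by (simp add: of_nat_diff)
  then have "real D powi (1 - int CARD('n)) = real D powi (- int (CARD('n) - 1))"
    by (simp only:)
  then show ?thesis
    by (simp only: power_int_minus power_int_of_nat inverse_eq_divide)
qed

theorem theorem1p1:
  fixes p :: "nat \<Rightarrow> real"
    and M :: "nat \<Rightarrow> ('n::finite, 'k::field) mpoly set pmf"
  assumes p: "\<And>D. D \<ge> 1 \<Longrightarrow> 0 \<le> p D \<and> p D \<le> 1"
    and M: "\<And>D. D \<ge> 1 \<Longrightarrow> M D = random_monomial_ideal D (p D)"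
  shows "(p \<lless> (\<lambda>D. real D powi (1 - int CARD('n))) \<longrightarrow>
            asymp_almost_surely M (\<lambda>J. pdim_quot TYPE('i::infinite) J = 0))
       \<and> ((\<lambda>D. real D powi (1 - int CARD('n))) \<lless> p \<longrightarrow>
            asymp_almost_surely M (\<lambda>J. pdim_quot TYPE('i) J = enat CARD('n)))"
proof (intro conjI impI)
  let ?n = "CARD('n)"
  have large: "\<forall>\<^sub>F D in sequentially. D \<ge> (1 :: nat)"
    by (rule eventually_ge_at_top)
  {
    assume "p \<lless> (\<lambda>D. real D powi (1 - int ?n))"
    then have "(\<lambda>D. p D / real D powi (1 - int ?n)) \<longlonglongrightarrow> 0"
      by (simp add: much_less_def)
    then have lim: "(\<lambda>D. 2 ^ (?n - 1) * (p D / real D powi (1 - int ?n))) \<longlonglongrightarrow> 0"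
      using tendsto_mult_right_zero by blast
    show "asymp_almost_surely M (\<lambda>J. pdim_quot TYPE('i) J = 0)"
    proof (rule asymp_almost_surelyI[OF _ lim], use large in eventually_elim)
      fix D :: nat assume D: "D \<ge> 1"
      \<comment> \<open>\<open>D + 1 \<le> 2 * D\<close> trades the bound in \<open>D + 1\<close>
        for one in \<open>D\<close>; this is the source of the factor
        \<open>2 ^ (?n - 1)\<close>.\<close>
      have "real (D + 1) ^ (?n - 1) * p D \<le> (2 * real D) ^ (?n - 1) * p D"
        using p[OF D] D by (intro mult_right_mono power_mono) auto
      also have "\<dots> = 2 ^ (?n - 1) * (p D / real D powi (1 - int ?n))"
        using D by (simp add: powi_one_minus_card power_mult_distrib)
      finally show "1 - 2 ^ (?n - 1) * (p D / real D powi (1 - int ?n))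
          \<le> measure_pmf.prob (M D) {J. pdim_quot TYPE('i) J = 0}"
        using prob_pdim_eq_0_ge[of "p D" D, where 'n = 'n and 'k = 'k and 'i = 'i] p[OF D] M[OF D]
        by simp
    qed
  }
  {
    assume "(\<lambda>D. real D powi (1 - int ?n)) \<lless> p"
    then have nz: "\<forall>\<^sub>F D in sequentially. p D \<noteq> 0"
      and lim: "(\<lambda>D. real D powi (1 - int ?n) / p D) \<longlonglongrightarrow> 0"
      by (auto simp: much_less_def)
    have "\<forall>\<^sub>F D in sequentially. real D powi (1 - int ?n) / p D > 0"
      using nz large
    proof eventually_elim
      case (elim D)
      then show ?case
        using p[of D] by (simp add: less_le)
    qed
    \<comment> \<open>The inverse of a null sequence tends to infinity only if the sequence is
      eventually positive. That holds because \<open>p D\<close> is eventually nonzero by the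
      definition of \<open>\<lless>\<close>.\<close>
    then have "filterlim (\<lambda>D. inverse (real D powi (1 - int ?n) / p D)) at_top sequentially"
      using lim by (intro filterlim_inverse_at_top)
    \<comment> \<open>The constant comes from \<open>(real D / real ?n) ^ (?n - 1)\<close> in the
      probability bound.\<close>
    then have "filterlim (\<lambda>D. inverse (real ?n ^ (?n - 1)) * inverse (real D powi (1 - int ?n) / p D))
        at_top sequentially"
      by (intro filterlim_tendsto_pos_mult_at_top[OF tendsto_const]) auto
    then have "((\<lambda>D. exp (- (inverse (real ?n ^ (?n - 1)) * inverse (real D powi (1 - int ?n) / p D))))
        \<longlongrightarrow> 0) sequentially"
      by (intro filterlim_compose[OF exp_at_bot] filterlim_compose[OF filterlim_uminus_at_bot_at_top])
    then have lim': "(\<lambda>D. real ?n * exp (- (inverse (real ?n ^ (?n - 1)) *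
        inverse (real D powi (1 - int ?n) / p D)))) \<longlonglongrightarrow> 0"
      by (rule tendsto_mult_right_zero)
    show "asymp_almost_surely M (\<lambda>J. pdim_quot TYPE('i) J = enat ?n)"
    proof (rule asymp_almost_surelyI[OF _ lim'], use large in eventually_elim)
      fix D :: nat assume D: "D \<ge> 1"
      have "inverse (real ?n ^ (?n - 1)) * inverse (real D powi (1 - int ?n) / p D)
          = p D * (real D / real ?n) ^ (?n - 1)"
        using D by (simp add: powi_one_minus_card power_divide field_simps)
      then show "1 - real ?n * exp (- (inverse (real ?n ^ (?n - 1)) * inverse (real D powi (1 - int ?n) / p D)))
          \<le> measure_pmf.prob (M D) {J. pdim_quot TYPE('i) J = enat ?n}"
        using prob_pdim_eq_card_ge[of "p D" D, where 'n = 'n and 'k = 'k and 'i = 'i] p[OF D] M[OF D] D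
        by simp
    qed
  }
qed

end
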